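(* Let $X$ be a super-reflexive Banach space, $U\subset X$ an open quasiconvex set, and $f\in C^{1,+}(U)$. Suppose that at least one of the following two conditions is satisfied: (a) $X$ has an equivalent norm with modulus of smoothness of power type $2$, (b) $U$ is bounded. Then $f$ can be extended to a function $F\in C^{1,+}(X)$.
   Context: All normed linear spaces are real and $Df$ denotes the Fréchet derivative. For an open subset $U$ of a normed linear space, $C^{1,+}(U)$ is the set of all Fréchet differentiable $f\colon U\to\mathbb R$ such that $Df$ is uniformly continuous on $U$. A metric space $(Z,\rho)$ is $c$-quasiconvex ($c\ge1$) if for each $x,y\in Z$ there is a continuous rectifiable curve $\gamma\colon[0,1]\to Z$ with $\gamma(0)=x$, $\gamma(1)=y$ and length (variation) at most $c\rho(x,y)$; it is quasiconvex if it is $c$-quasiconvex for some $c\ge1$. Subsets of normed spaces carry the norm metric. The modulus of smoothness of a norm $\|\cdot\|$ on $X$ is $\rho(\tau)=\sup\{\frac{\|x+\tau y\|+\|x-\tau y\|}{2}-1 : x,y\in X,\ \|x\|=\|y\|=1\}$, $\tau\ge0$; it is of power type $p>1$ if there is $K>0$ with $\rho(\tau)\le K\tau^p$ for all $\tau\ge0$. A Banach space is super-reflexive if and only if it has an equivalent uniformly smooth norm. *)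

theory Defs
  imports "HOL-Analysis.Analysis"
begin

section \<open>Equivalent norms and their smoothness\<close>

definition equivalent_norm :: "('a::real_normed_vector \<Rightarrow> real) \<Rightarrow> bool" where
  "equivalent_norm N \<longleftrightarrow>
     (\<forall>x. 0 \<le> N x) \<and> (\<forall>x. N x = 0 \<longleftrightarrow> x = 0) \<and>
     (\<forall>a x. N (a *\<^sub>R x) = \<bar>a\<bar> * N x) \<and>
     (\<forall>x y. N (x + y) \<le> N x + N y) \<and>
     (\<exists>c>0. \<exists>C>0. \<forall>x. c * norm x \<le> N x \<and> N x \<le> C * norm x)"

text \<open>
  For a norm \<open>N\<close> and \<open>\<tau> \<ge> 0\<close> all members of the set below lie
  between \<open>-1\<close> and \<open>\<tau>\<close>. If the space is nontrivial, the supremum is nonnegative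
  already without the extra \<open>0\<close> (since \<open>2 N x \<le> N (x + \<tau> y) + N (x - \<tau> y)\<close>); the \<open>0\<close> only
  matters for the zero space, whose unit sphere is empty and whose modulus is thereby \<open>0\<close>
  (in type \<^typ>\<open>real\<close> the supremum of the empty set is unspecified).
\<close>

definition modulus_of_smoothness :: "('a::real_vector \<Rightarrow> real) \<Rightarrow> real \<Rightarrow> real" where
  "modulus_of_smoothness N \<tau> =
     Sup (insert 0 {(N (x + \<tau> *\<^sub>R y) + N (x - \<tau> *\<^sub>R y)) / 2 - 1 | x y. N x = 1 \<and> N y = 1})"

definition smoothness_power_type :: "('a::real_vector \<Rightarrow> real) \<Rightarrow> real \<Rightarrow> bool" where
  "smoothness_power_type N p \<longleftrightarrow>
     p > 1 \<and> (\<exists>K>0. \<forall>\<tau>\<ge>0. modulus_of_smoothness N \<tau> \<le> K * \<tau> powr p)"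

definition uniformly_smooth :: "('a::real_vector \<Rightarrow> real) \<Rightarrow> bool" where
  "uniformly_smooth N \<longleftrightarrow> ((\<lambda>\<tau>. modulus_of_smoothness N \<tau> / \<tau>) \<longlongrightarrow> 0) (at_right 0)"

text \<open>
  Super-reflexivity is a property of the whole space, that is, of the type. The description by
  finite representability (every Banach space finitely representable in the given one is
  reflexive) quantifies over all Banach spaces; super-reflexivity is taken here in the sense of
  having an equivalent uniformly smooth norm.
\<close>

definition super_reflexive :: "'a::banach itself \<Rightarrow> bool" where
  "super_reflexive _ \<longleftrightarrow> (\<exists>N :: 'a \<Rightarrow> real. equivalent_norm N \<and> uniformly_smooth N)"

section \<open>Quasiconvex sets\<close>

text \<open>
  The length of a curve on \<open>[0,1]\<close> as an extended nonnegative real: the supremum over all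
  \<open>0 \<le> t 0 \<le> \<dots> \<le> t n \<le> 1\<close>; rectifiable means finite length.
\<close>

definition curve_length :: "(real \<Rightarrow> 'a::metric_space) \<Rightarrow> ennreal" where
  "curve_length \<gamma> =
     (SUP (n, t) \<in> {(n :: nat, t :: nat \<Rightarrow> real). mono_on {..n} t \<and> t ` {..n} \<subseteq> {0..1}}.
        ennreal (\<Sum>i<n. dist (\<gamma> (t i)) (\<gamma> (t (Suc i)))))"

definition quasiconvex_with :: "real \<Rightarrow> 'a::metric_space set \<Rightarrow> bool" where
  "quasiconvex_with c Z \<longleftrightarrow>
     (\<forall>x\<in>Z. \<forall>y\<in>Z. \<exists>\<gamma>. path \<gamma> \<and> path_image \<gamma> \<subseteq> Z \<and> pathstart \<gamma> = x \<and> pathfinish \<gamma> = y \<and>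
        curve_length \<gamma> < \<infinity> \<and> curve_length \<gamma> \<le> ennreal (c * dist x y))"

definition quasiconvex :: "'a::metric_space set \<Rightarrow> bool" where
  "quasiconvex Z \<longleftrightarrow> (\<exists>c\<ge>1. quasiconvex_with c Z)"

section \<open>Functions with uniformly continuous derivative\<close>

text \<open>
  Meant for open \<open>U\<close>, where the derivative is unique. Uniform continuity of the derivative is
  with respect to the operator norm on the dual space \<^typ>\<open>'a::real_normed_vector \<Rightarrow>\<^sub>L real\<close>.
\<close>

definition C1_plus_on :: "('a::real_normed_vector \<Rightarrow> real) \<Rightarrow> 'a set \<Rightarrow> bool"
    (infix \<open>C1'_plus'_on\<close> 50) where
  "f C1_plus_on U \<longleftrightarrow>
     (\<exists>Df :: 'a \<Rightarrow> 'a \<Rightarrow>\<^sub>L real.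
        (\<forall>x\<in>U. (f has_derivative blinfun_apply (Df x)) (at x)) \<and> uniformly_continuous_on U Df)"

end

theory Submission
  imports Defs
begin

text \<open>
  The extension is inserted between two explicit bounds. Write \<open>Df\<close> for the derivative of \<open>f\<close>
  on \<open>U\<close>. If \<open>\<phi> \<ge> 0\<close> is a convex function with \<open>\<phi> 0 = 0\<close>, then the functions
  \<open>lo x = (SUP y\<in>U. f y + Df y (x - y) - \<phi> (x - y))\<close> and
  \<open>up x = (INF y\<in>U. f y + Df y (x - y) + \<phi> (x - y))\<close> both equal \<open>f\<close> on \<open>U\<close> as soon as
  \<open>lo \<le> up\<close>. If moreover the second differences \<open>\<phi> (x + h) + \<phi> (x - h) - 2 \<phi> x\<close> are
  \<open>o(\<parallel>h\<parallel>)\<close> uniformly in \<open>x\<close>, then every summand of \<open>lo\<close> is semiconvex with one common modulus,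
  hence so is \<open>lo\<close>, and symmetrically \<open>up\<close> is semiconcave.

  Three ideas carry the proof.

  (1) Between a semiconvex function and a semiconcave function above it there is one that is both
  (\<open>semiconvex_semiconcave_insertion\<close>): the largest semiconvex function below \<open>up\<close>. It is
  semiconcave because the class of competitors is invariant under translations and convex
  combinations. This is an Ilmanen type lemma, and it holds in every normed space.

  (2) A function that is uniformly semiconvex and uniformly semiconcave, with error \<open>o(\<parallel>x - y\<parallel>)\<close>,
  has a uniformly continuous derivative (\<open>semiconvex_semiconcave_C1_plus\<close>): its difference
  quotients are Cauchy, and comparing the midpoints of the diagonals of a parallelogram compares
  the derivatives at two points.

  (3) The geometry of the space enters only in the choice of \<open>\<phi>\<close>. The inequality \<open>lo \<le> up\<close>
  follows from \<open>\<phi> v \<ge> 3 c \<parallel>v\<parallel> \<omega> (2 c \<parallel>v\<parallel>)\<close>, where \<open>\<omega>\<close> is the modulus of continuity of \<open>Df\<close> and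
  \<open>c\<close> the quasiconvexity constant; the Taylor estimate that this rests on is integrated along
  short curves (\<open>taylor_bound_quasiconvex\<close>). A uniformly smooth norm, flattened near \<open>0\<close>, gives
  one function of linear growth with the required second differences, and a weighted sum of its
  rescalings adapts to any rate at which \<open>\<omega>\<close> tends to \<open>0\<close> (\<open>superposition_of_scales\<close>). For
  large arguments quasiconvexity only gives \<open>\<omega> t \<le> 1 + B t\<close>
  (\<open>quasiconvex_uniformly_continuous_growth\<close>), so \<open>\<phi>\<close> may have to grow quadratically. This is
  where the alternative of the theorem is used: if the modulus of smoothness of the norm has power
  type 2, the square of the norm is available, and if \<open>U\<close> is bounded, then \<open>\<omega>\<close> is bounded and
  linear growth is enough.
\<close>

section \<open>Functions that are uniformly semiconvex with a given gauge\<close>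

text \<open>
  The modulus of semiconvexity is recorded by its inverse: \<open>\<delta> \<epsilon>\<close> is a distance below which the
  error is at most \<open>\<epsilon>\<close> times the distance. At larger distances the error may grow at any
  rate. Fixing \<open>\<delta>\<close> makes the class closed under suprema, translations and convex combinations.
\<close>

definition semiconvex_gauge :: "(real \<Rightarrow> real) \<Rightarrow> ('a::real_normed_vector \<Rightarrow> real) \<Rightarrow> bool" where
  "semiconvex_gauge \<delta> h \<longleftrightarrow>
     (\<forall>\<epsilon>>0. \<forall>x y. norm (x - y) \<le> \<delta> \<epsilon> \<longrightarrow>
        (\<forall>t\<in>{0..1}. h (t *\<^sub>R x + (1 - t) *\<^sub>R y)
                      \<le> t * h x + (1 - t) * h y + t * (1 - t) * \<epsilon> * norm (x - y)))"

lemma semiconvex_gaugeD: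
  assumes "semiconvex_gauge \<delta> h" "0 < \<epsilon>" "norm (x - y) \<le> \<delta> \<epsilon>" "0 \<le> t" "t \<le> 1"
  shows "h (t *\<^sub>R x + (1 - t) *\<^sub>R y) \<le> t * h x + (1 - t) * h y + t * (1 - t) * \<epsilon> * norm (x - y)"
  using assms unfolding semiconvex_gauge_def by auto

lemma semiconvex_gauge_SUP:
  fixes h :: "'i \<Rightarrow> 'a::real_normed_vector \<Rightarrow> real"
  assumes h: "\<And>i. i \<in> I \<Longrightarrow> semiconvex_gauge \<delta> (h i)"
    and ne: "I \<noteq> {}" and bdd: "\<And>x. bdd_above ((\<lambda>i. h i x) ` I)"
  shows "semiconvex_gauge \<delta> (\<lambda>x. SUP i\<in>I. h i x)"
  unfolding semiconvex_gauge_def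
proof (intro allI impI ballI)
  fix \<epsilon> t :: real and x y :: 'a
  assume *: "0 < \<epsilon>" "norm (x - y) \<le> \<delta> \<epsilon>" "t \<in> {0..1}"
  show "(SUP i\<in>I. h i (t *\<^sub>R x + (1 - t) *\<^sub>R y))
      \<le> t * (SUP i\<in>I. h i x) + (1 - t) * (SUP i\<in>I. h i y) + t * (1 - t) * \<epsilon> * norm (x - y)"
  proof (rule cSUP_least[OF ne])
    fix i assume i: "i \<in> I"
    have "h i (t *\<^sub>R x + (1 - t) *\<^sub>R y)
        \<le> t * h i x + (1 - t) * h i y + t * (1 - t) * \<epsilon> * norm (x - y)"
      using semiconvex_gaugeD[OF h[OF i]] * by auto
    moreover have "t * h i x \<le> t * (SUP i\<in>I. h i x)"
      using * by (intro mult_left_mono cSUP_upper[OF i] bdd) auto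
    moreover have "(1 - t) * h i y \<le> (1 - t) * (SUP i\<in>I. h i y)"
      using * by (intro mult_left_mono cSUP_upper[OF i] bdd) auto
    ultimately show "h i (t *\<^sub>R x + (1 - t) *\<^sub>R y)
      \<le> t * (SUP i\<in>I. h i x) + (1 - t) * (SUP i\<in>I. h i y) + t * (1 - t) * \<epsilon> * norm (x - y)"
      by linarith
  qed
qed

lemma semiconvex_gauge_translate:
  assumes "semiconvex_gauge \<delta> h"
  shows "semiconvex_gauge \<delta> (\<lambda>x. h (x + a))"
  unfolding semiconvex_gauge_def
proof (intro allI impI ballI)
  fix \<epsilon> t :: real and x y :: 'a
  assume *: "0 < \<epsilon>" "norm (x - y) \<le> \<delta> \<epsilon>" "t \<in> {0..1}"
  have "t *\<^sub>R x + (1 - t) *\<^sub>R y + a = t *\<^sub>R (x + a) + (1 - t) *\<^sub>R (y + a)"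
    by (simp add: algebra_simps)
  then show "h (t *\<^sub>R x + (1 - t) *\<^sub>R y + a)
      \<le> t * h (x + a) + (1 - t) * h (y + a) + t * (1 - t) * \<epsilon> * norm (x - y)"
    using semiconvex_gaugeD[OF assms *(1), of "x + a" "y + a" t] * by simp
qed

lemma semiconvex_gauge_add_affine:
  assumes h: "semiconvex_gauge \<delta> h" and L: "linear L"
  shows "semiconvex_gauge \<delta> (\<lambda>x. b + L x + h x)"
  unfolding semiconvex_gauge_def
proof (intro allI impI ballI)
  fix \<epsilon> t :: real and x y :: 'a
  assume *: "0 < \<epsilon>" "norm (x - y) \<le> \<delta> \<epsilon>" "t \<in> {0..1}"
  have "b + L (t *\<^sub>R x + (1 - t) *\<^sub>R y) = t * (b + L x) + (1 - t) * (b + L y)"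
    by (simp only: linear_add[OF L] linear_cmul[OF L]) (simp add: algebra_simps)
  then show "b + L (t *\<^sub>R x + (1 - t) *\<^sub>R y) + h (t *\<^sub>R x + (1 - t) *\<^sub>R y)
      \<le> t * (b + L x + h x) + (1 - t) * (b + L y + h y) + t * (1 - t) * \<epsilon> * norm (x - y)"
    using semiconvex_gaugeD[OF h *(1,2), of t] * by (simp add: algebra_simps)
qed

lemma semiconvex_gauge_convex_combination:
  assumes g: "semiconvex_gauge \<delta> g" and h: "semiconvex_gauge \<delta> h" and s: "0 \<le> s" "s \<le> 1"
  shows "semiconvex_gauge \<delta> (\<lambda>x. s * g x + (1 - s) * h x - b)"
  unfolding semiconvex_gauge_def
proof (intro allI impI ballI)
  fix \<epsilon> t :: real and x y :: 'a
  assume *: "0 < \<epsilon>" "norm (x - y) \<le> \<delta> \<epsilon>" "t \<in> {0..1}"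
  let ?e = "t * (1 - t) * \<epsilon> * norm (x - y)"
  have "s * g (t *\<^sub>R x + (1 - t) *\<^sub>R y) \<le> s * (t * g x + (1 - t) * g y + ?e)"
    using semiconvex_gaugeD[OF g *(1,2), of t] * s by (intro mult_left_mono) auto
  moreover have "(1 - s) * h (t *\<^sub>R x + (1 - t) *\<^sub>R y) \<le> (1 - s) * (t * h x + (1 - t) * h y + ?e)"
    using semiconvex_gaugeD[OF h *(1,2), of t] * s by (intro mult_left_mono) auto
  moreover have "s * (t * g x + (1 - t) * g y + ?e) + (1 - s) * (t * h x + (1 - t) * h y + ?e) - b
      = t * (s * g x + (1 - s) * h x - b) + (1 - t) * (s * g y + (1 - s) * h y - b) + ?e"
    by (simp add: algebra_simps)
  ultimately show "s * g (t *\<^sub>R x + (1 - t) *\<^sub>R y) + (1 - s) * h (t *\<^sub>R x + (1 - t) *\<^sub>R y) - b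
      \<le> t * (s * g x + (1 - s) * h x - b) + (1 - t) * (s * g y + (1 - s) * h y - b) + ?e"
    by linarith
qed

text \<open>
  \<open>F\<close> is the pointwise largest semiconvex function below \<open>up\<close>. To see that it is semiconcave at
  \<open>z = t x + (1 - t) y\<close>, average the translates of \<open>F\<close> that carry \<open>z\<close> to \<open>x\<close> and to \<open>y\<close> and
  subtract the admissible error. The result \<open>G\<close> is again semiconvex, it lies below \<open>up\<close> because
  \<open>F\<close> does and \<open>up\<close> is semiconcave, so \<open>G z \<le> F z\<close> by maximality.
\<close>

lemma semiconvex_semiconcave_insertion:
  fixes lo up :: "'a::real_normed_vector \<Rightarrow> real"
  assumes lo: "semiconvex_gauge \<delta> lo" and up: "semiconvex_gauge \<delta> (\<lambda>x. - up x)"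
    and le: "\<And>x. lo x \<le> up x"
  obtains F where "semiconvex_gauge \<delta> F" "semiconvex_gauge \<delta> (\<lambda>x. - F x)"
    "\<And>x. lo x \<le> F x" "\<And>x. F x \<le> up x"
proof -
  define A where "A = {h. semiconvex_gauge \<delta> h \<and> (\<forall>x. h x \<le> up x)}"
  define F where "F x = (SUP h\<in>A. h x)" for x
  have loA: "lo \<in> A" using lo le by (auto simp: A_def)
  have bdd: "bdd_above ((\<lambda>h. h x) ` A)" for x
    unfolding A_def by (rule bdd_aboveI[of _ "up x"]) auto
  have Fup: "F x \<le> up x" for x
    unfolding F_def using loA by (intro cSUP_least) (auto simp: A_def)
  have F_ge: "h x \<le> F x" if "h \<in> A" for h x
    unfolding F_def by (rule cSUP_upper[OF that bdd])
  have F: "semiconvex_gauge \<delta> F"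
    unfolding F_def[abs_def] using loA bdd by (intro semiconvex_gauge_SUP) (auto simp: A_def)
  have "semiconvex_gauge \<delta> (\<lambda>x. - F x)"
    unfolding semiconvex_gauge_def
  proof (intro allI impI ballI)
    fix \<epsilon> t :: real and x y :: 'a
    assume *: "0 < \<epsilon>" "norm (x - y) \<le> \<delta> \<epsilon>" "t \<in> {0..1}"
    define e where "e = t * (1 - t) * \<epsilon> * norm (x - y)"
    define z where "z = t *\<^sub>R x + (1 - t) *\<^sub>R y"
    define G where "G w = t * F (w + (1 - t) *\<^sub>R (x - y)) + (1 - t) * F (w + (- t) *\<^sub>R (x - y)) - e" for w
    have "G w \<le> up w" for w
    proof -
      let ?p = "w + (1 - t) *\<^sub>R (x - y)" and ?q = "w + (- t) *\<^sub>R (x - y)"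
      have pq: "?p - ?q = x - y" "t *\<^sub>R ?p + (1 - t) *\<^sub>R ?q = w"
        by (simp_all add: algebra_simps)
      have "- up w \<le> t * - up ?p + (1 - t) * - up ?q + e"
        using semiconvex_gaugeD[OF up *(1), of ?p ?q t] * unfolding pq e_def by simp
      moreover have "t * F ?p \<le> t * up ?p" "(1 - t) * F ?q \<le> (1 - t) * up ?q"
        using * by (auto intro!: mult_left_mono Fup)
      ultimately show ?thesis unfolding G_def by simp
    qed
    moreover have "semiconvex_gauge \<delta> G"
      unfolding G_def[abs_def] using *
      by (intro semiconvex_gauge_convex_combination semiconvex_gauge_translate F) auto
    ultimately have "G z \<le> F z" by (intro F_ge) (auto simp: A_def)
    moreover have "z + (1 - t) *\<^sub>R (x - y) = x" "z + (- t) *\<^sub>R (x - y) = y"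
      by (simp_all add: z_def algebra_simps)
    ultimately show "- F (t *\<^sub>R x + (1 - t) *\<^sub>R y) \<le> t * - F x + (1 - t) * - F y
        + t * (1 - t) * \<epsilon> * norm (x - y)"
      unfolding G_def e_def z_def by simp
  qed
  then show thesis using that F F_ge[OF loA] Fup by blast
qed

section \<open>Semiconvex and semiconcave functions have a uniformly continuous derivative\<close>

lemma zero_if_le_multiple_of_every_positive:
  fixes a K :: real
  assumes "\<And>\<epsilon>. 0 < \<epsilon> \<Longrightarrow> \<bar>a\<bar> \<le> K * \<epsilon>"
  shows "a = 0"
proof (rule ccontr)
  assume "a \<noteq> 0"
  have "\<bar>a\<bar> \<le> K * (\<bar>a\<bar> / (2 * (\<bar>K\<bar> + 1)))" using \<open>a \<noteq> 0\<close> by (intro assms) auto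
  also have "\<dots> \<le> (\<bar>K\<bar> + 1) * (\<bar>a\<bar> / (2 * (\<bar>K\<bar> + 1)))" by (intro mult_right_mono) auto
  also have "\<dots> = \<bar>a\<bar> / 2" by (simp add: divide_simps)
  finally show False using \<open>a \<noteq> 0\<close> by simp
qed

lemma two_sided_bound:
  assumes "semiconvex_gauge \<delta> F" "semiconvex_gauge \<delta> (\<lambda>x. - F x)"
    and "0 < \<epsilon>" "norm (x - y) \<le> \<delta> \<epsilon>" "0 \<le> t" "t \<le> 1"
  shows "\<bar>t * F x + (1 - t) * F y - F (t *\<^sub>R x + (1 - t) *\<^sub>R y)\<bar> \<le> t * (1 - t) * \<epsilon> * norm (x - y)"
  using semiconvex_gaugeD[OF assms(1,3-6)] semiconvex_gaugeD[OF assms(2,3-6)] by (simp add: abs_le_iff)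

lemma midpoint_bound:
  assumes "semiconvex_gauge \<delta> F" "semiconvex_gauge \<delta> (\<lambda>x. - F x)"
    and "0 < \<epsilon>" "norm (x - y) \<le> \<delta> \<epsilon>"
  shows "\<bar>F x + F y - 2 * F ((1/2) *\<^sub>R (x + y))\<bar> \<le> \<epsilon> * norm (x - y) / 2"
proof -
  have "(1/2) *\<^sub>R x + (1 - 1/2) *\<^sub>R y = (1/2) *\<^sub>R (x + y)" by (simp add: algebra_simps)
  then show ?thesis using two_sided_bound[OF assms, of "1/2"] by (simp add: abs_if split: if_splits)
qed

text \<open>
  Along the fixed sequence \<open>1 / (n + 1)\<close>; for the functions considered here the limit over all
  positive steps exists and is the same.
\<close>

definition directional_derivative :: "('a::real_vector \<Rightarrow> real) \<Rightarrow> 'a \<Rightarrow> 'a \<Rightarrow> real" where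
  "directional_derivative F x v = lim (\<lambda>n. (F (x + inverse (real (Suc n)) *\<^sub>R v) - F x) / inverse (real (Suc n)))"

context
  fixes \<delta> :: "real \<Rightarrow> real" and F :: "'a::real_normed_vector \<Rightarrow> real"
  assumes F: "semiconvex_gauge \<delta> F" and minus_F: "semiconvex_gauge \<delta> (\<lambda>x. - F x)"
    and gauge_pos: "\<And>\<epsilon>. 0 < \<epsilon> \<Longrightarrow> 0 < \<delta> \<epsilon>"
begin

text \<open>
  The point \<open>x + s v\<close> divides the segment from \<open>x\<close> to \<open>x + r v\<close>, so the two-sided inequality
  compares the two slopes directly.
\<close>

lemma difference_quotients_close:
  assumes "0 < \<epsilon>" "0 < s" "s \<le> r" "r * norm v \<le> \<delta> \<epsilon>"
  shows "\<bar>(F (x + r *\<^sub>R v) - F x) / r - (F (x + s *\<^sub>R v) - F x) / s\<bar> \<le> \<epsilon> * norm v"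
proof -
  have eq: "(s / r) *\<^sub>R (x + r *\<^sub>R v) + (1 - s / r) *\<^sub>R x = x + s *\<^sub>R v"
    using assms by (simp add: algebra_simps)
  have "\<bar>(s / r) * F (x + r *\<^sub>R v) + (1 - s / r) * F x - F (x + s *\<^sub>R v)\<bar>
      \<le> (s / r) * (1 - s / r) * \<epsilon> * norm ((x + r *\<^sub>R v) - x)"
    using two_sided_bound[OF F minus_F assms(1), of "x + r *\<^sub>R v" x "s / r"] assms
    unfolding eq by simp
  also have "\<dots> = s * ((1 - s / r) * (\<epsilon> * norm v))" using assms by simp
  also have "\<dots> \<le> s * (1 * (\<epsilon> * norm v))"
    using assms by (intro mult_left_mono mult_right_mono) auto
  finally have *: "\<bar>(s / r) * F (x + r *\<^sub>R v) + (1 - s / r) * F x - F (x + s *\<^sub>R v)\<bar> \<le> s * (\<epsilon> * norm v)"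
    by simp
  have "(F (x + r *\<^sub>R v) - F x) / r - (F (x + s *\<^sub>R v) - F x) / s
     = ((s / r) * F (x + r *\<^sub>R v) + (1 - s / r) * F x - F (x + s *\<^sub>R v)) / s"
    using assms by (simp add: field_simps)
  then have "\<bar>(F (x + r *\<^sub>R v) - F x) / r - (F (x + s *\<^sub>R v) - F x) / s\<bar>
     = \<bar>(s / r) * F (x + r *\<^sub>R v) + (1 - s / r) * F x - F (x + s *\<^sub>R v)\<bar> / s"
    using assms by simp
  also have "\<dots> \<le> s * (\<epsilon> * norm v) / s"
    using * assms by (intro divide_right_mono) auto
  finally show ?thesis using assms by simp
qed

lemma directional_derivative_LIMSEQ:
  "(\<lambda>n. (F (x + inverse (real (Suc n)) *\<^sub>R v) - F x) / inverse (real (Suc n)))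
     \<longlonglongrightarrow> directional_derivative F x v" (is "?q \<longlonglongrightarrow> _")
proof -
  have "Cauchy ?q"
  proof (rule metric_CauchyI)
    fix e :: real assume "0 < e"
    define c where "c = norm v + 1"
    have c: "0 < c" "norm v \<le> c" unfolding c_def using norm_ge_zero[of v] by linarith+
    define \<epsilon> where "\<epsilon> = e / 2 / c"
    have \<epsilon>: "0 < \<epsilon>" unfolding \<epsilon>_def using \<open>0 < e\<close> c by simp
    have "\<epsilon> * norm v \<le> \<epsilon> * c" using \<epsilon> c by simp
    also have "\<dots> = e / 2" unfolding \<epsilon>_def using c by simp
    finally have ev: "\<epsilon> * norm v < e" using \<open>0 < e\<close> by simp
    have "(\<lambda>n. inverse (real (Suc n)) * norm v) \<longlonglongrightarrow> 0"
      using tendsto_mult_left_zero[OF LIMSEQ_inverse_real_of_nat] by simp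
    then have "eventually (\<lambda>n. inverse (real (Suc n)) * norm v < \<delta> \<epsilon>) sequentially"
      using gauge_pos[OF \<epsilon>] by (rule order_tendstoD)
    then obtain M where M: "\<And>n. n \<ge> M \<Longrightarrow> inverse (real (Suc n)) * norm v < \<delta> \<epsilon>"
      unfolding eventually_sequentially by auto
    have wlog: "dist (?q m) (?q n) < e" if "M \<le> m" "m \<le> n" for m n
    proof -
      have "\<bar>?q m - ?q n\<bar> \<le> \<epsilon> * norm v"
        by (rule difference_quotients_close[OF \<epsilon>])
           (use that M[of m] in \<open>auto simp: le_imp_inverse_le\<close>)
      then show ?thesis using ev by (simp add: dist_real_def)
    qed
    have "dist (?q m) (?q n) < e" if "M \<le> m" "M \<le> n" for m n
    proof (cases "m \<le> n")
      case True then show ?thesis using wlog that by blast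
    next
      case False then show ?thesis using that by (subst dist_commute, intro wlog) auto
    qed
    then show "\<exists>M. \<forall>m\<ge>M. \<forall>n\<ge>M. dist (?q m) (?q n) < e" by blast
  qed
  then show ?thesis
    unfolding directional_derivative_def by (simp add: Cauchy_convergent_iff convergent_LIMSEQ_iff)
qed

lemma directional_derivative_approx_scaled:
  assumes "0 < \<epsilon>" "0 < r" "r * norm v \<le> \<delta> \<epsilon>"
  shows "\<bar>(F (x + r *\<^sub>R v) - F x) / r - directional_derivative F x v\<bar> \<le> \<epsilon> * norm v"
proof (rule tendsto_upperbound)
  let ?q = "\<lambda>n. (F (x + inverse (real (Suc n)) *\<^sub>R v) - F x) / inverse (real (Suc n))"
  show "(\<lambda>n. \<bar>(F (x + r *\<^sub>R v) - F x) / r - ?q n\<bar>)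
      \<longlonglongrightarrow> \<bar>(F (x + r *\<^sub>R v) - F x) / r - directional_derivative F x v\<bar>"
    by (intro tendsto_intros directional_derivative_LIMSEQ)
  have "eventually (\<lambda>n. inverse (real (Suc n)) < r) sequentially"
    using LIMSEQ_inverse_real_of_nat \<open>0 < r\<close> by (rule order_tendstoD)
  then show "eventually (\<lambda>n. \<bar>(F (x + r *\<^sub>R v) - F x) / r - ?q n\<bar> \<le> \<epsilon> * norm v) sequentially"
    by eventually_elim (rule difference_quotients_close, use assms in auto)
qed simp

lemma directional_derivative_approx:
  assumes "0 < \<epsilon>" "norm v \<le> \<delta> \<epsilon>"
  shows "\<bar>F (x + v) - F x - directional_derivative F x v\<bar> \<le> \<epsilon> * norm v"
  using directional_derivative_approx_scaled[of \<epsilon> 1 v x] assms by simp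

lemma common_small_scale:
  assumes "0 < \<epsilon>"
  obtains s where "0 < s" "s * C \<le> \<delta> \<epsilon>"
proof
  show "0 < \<delta> \<epsilon> / (\<bar>C\<bar> + 1)" using gauge_pos[OF assms] by simp
  have "\<delta> \<epsilon> * C \<le> \<delta> \<epsilon> * (\<bar>C\<bar> + 1)"
    using gauge_pos[OF assms] by (intro mult_left_mono) auto
  then show "\<delta> \<epsilon> / (\<bar>C\<bar> + 1) * C \<le> \<delta> \<epsilon>" by (simp add: divide_simps)
qed

text \<open>
  The point \<open>x + s (v + w)\<close> is the midpoint of \<open>x + 2 s v\<close> and \<open>x + 2 s w\<close>, at which \<open>F\<close> is almost
  the mean of the two values.
\<close>

lemma directional_derivative_add:
  "directional_derivative F x (v + w) = directional_derivative F x v + directional_derivative F x w"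
proof -
  let ?L = "directional_derivative F x" and ?K = "norm (v + w) + norm v + norm w + norm (v - w)"
  have "?L (v + w) - ?L v - ?L w = 0"
  proof (rule zero_if_le_multiple_of_every_positive[where K = ?K])
    fix \<epsilon> :: real assume \<epsilon>: "0 < \<epsilon>"
    obtain s where s: "0 < s" "s * (2 * ?K) \<le> \<delta> \<epsilon>" using common_small_scale[OF \<epsilon>] .
    have small: "s * C \<le> \<delta> \<epsilon>" if "C \<le> 2 * ?K" for C
      using mult_left_mono[OF that, of s] s by linarith
    let ?p = "x + (2 * s) *\<^sub>R v" and ?q = "x + (2 * s) *\<^sub>R w"
    have mid: "(1/2) *\<^sub>R (?p + ?q) = x + s *\<^sub>R (v + w)"
      by (simp add: algebra_simps) (simp add: scaleR_add_left[symmetric])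
    have pq: "?p - ?q = (2 * s) *\<^sub>R (v - w)" by (simp add: algebra_simps)
    have "\<bar>F ?p + F ?q - 2 * F (x + s *\<^sub>R (v + w))\<bar> \<le> \<epsilon> * norm (?p - ?q) / 2"
      unfolding mid[symmetric] 
      using midpoint_bound[OF F minus_F \<epsilon>, of ?p ?q] small[of "2 * norm (v - w)"] s
      unfolding pq by (simp add: mult.assoc mult.left_commute)
    also have "\<dots> = s * (\<epsilon> * norm (v - w))" unfolding pq using s by simp
    finally have 0: "\<bar>F ?p + F ?q - 2 * F (x + s *\<^sub>R (v + w))\<bar> \<le> s * (\<epsilon> * norm (v - w))" .
    have "(F (x + s *\<^sub>R (v + w)) - F x) / s - (F ?p - F x) / (2 * s) - (F ?q - F x) / (2 * s)
        = - (F ?p + F ?q - 2 * F (x + s *\<^sub>R (v + w))) / (2 * s)"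
      using s by (simp add: field_simps)
    then have "\<bar>(F (x + s *\<^sub>R (v + w)) - F x) / s - (F ?p - F x) / (2 * s) - (F ?q - F x) / (2 * s)\<bar>
        = \<bar>F ?p + F ?q - 2 * F (x + s *\<^sub>R (v + w))\<bar> / (2 * s)"
      using s by simp
    also have "\<dots> \<le> s * (\<epsilon> * norm (v - w)) / (2 * s)"
      using 0 s by (intro divide_right_mono) auto
    also have "\<dots> \<le> \<epsilon> * norm (v - w)" using s \<epsilon> by simp
    finally have 1: "\<bar>(F (x + s *\<^sub>R (v + w)) - F x) / s - (F ?p - F x) / (2 * s) - (F ?q - F x) / (2 * s)\<bar>
        \<le> \<epsilon> * norm (v - w)" .
    have 2: "\<bar>(F (x + s *\<^sub>R (v + w)) - F x) / s - ?L (v + w)\<bar> \<le> \<epsilon> * norm (v + w)"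
      using s by (intro directional_derivative_approx_scaled \<epsilon> small) (auto intro: add_increasing2)
    have 3: "\<bar>(F ?p - F x) / (2 * s) - ?L v\<bar> \<le> \<epsilon> * norm v"
      using s small[of "2 * norm v"]
      by (intro directional_derivative_approx_scaled \<epsilon>) (auto simp: mult_ac)
    have 4: "\<bar>(F ?q - F x) / (2 * s) - ?L w\<bar> \<le> \<epsilon> * norm w"
      using s small[of "2 * norm w"]
      by (intro directional_derivative_approx_scaled \<epsilon>) (auto simp: mult_ac)
    have "\<bar>?L (v + w) - ?L v - ?L w\<bar>
        \<le> \<epsilon> * norm (v + w) + \<epsilon> * norm v + \<epsilon> * norm w + \<epsilon> * norm (v - w)"
      using 1 2 3 4 by linarith
    then show "\<bar>?L (v + w) - ?L v - ?L w\<bar> \<le> ?K * \<epsilon>" by (simp add: algebra_simps)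
  qed
  then show ?thesis by simp
qed

lemma directional_derivative_scale_pos:
  assumes "0 < r"
  shows "directional_derivative F x (r *\<^sub>R v) = r * directional_derivative F x v"
proof -
  let ?L = "directional_derivative F x"
  have "?L (r *\<^sub>R v) - r * ?L v = 0"
  proof (rule zero_if_le_multiple_of_every_positive[where K = "2 * r * norm v"])
    fix \<epsilon> :: real assume \<epsilon>: "0 < \<epsilon>"
    obtain s where s: "0 < s" "s * (r * norm v) \<le> \<delta> \<epsilon>" using common_small_scale[OF \<epsilon>] .
    have 1: "\<bar>(F (x + s *\<^sub>R (r *\<^sub>R v)) - F x) / s - ?L (r *\<^sub>R v)\<bar> \<le> \<epsilon> * norm (r *\<^sub>R v)"
      using s assms by (intro directional_derivative_approx_scaled \<epsilon>) auto
    have "\<bar>(F (x + (s * r) *\<^sub>R v) - F x) / (s * r) - ?L v\<bar> \<le> \<epsilon> * norm v"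
      using s assms by (intro directional_derivative_approx_scaled \<epsilon>) (auto simp: mult_ac)
    then have "r * \<bar>(F (x + (s * r) *\<^sub>R v) - F x) / (s * r) - ?L v\<bar> \<le> r * (\<epsilon> * norm v)"
      using assms by simp
    moreover have "r * \<bar>(F (x + (s * r) *\<^sub>R v) - F x) / (s * r) - ?L v\<bar>
        = \<bar>r * ((F (x + (s * r) *\<^sub>R v) - F x) / (s * r) - ?L v)\<bar>"
      using assms by (simp add: abs_mult)
    moreover have "r * ((F (x + (s * r) *\<^sub>R v) - F x) / (s * r) - ?L v)
        = (F (x + s *\<^sub>R (r *\<^sub>R v)) - F x) / s - r * ?L v"
      using assms s by (simp add: field_simps)
    ultimately have 2: "\<bar>(F (x + s *\<^sub>R (r *\<^sub>R v)) - F x) / s - r * ?L v\<bar> \<le> r * (\<epsilon> * norm v)" by simp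
    have "\<epsilon> * norm (r *\<^sub>R v) = r * (\<epsilon> * norm v)" using assms by simp
    then show "\<bar>?L (r *\<^sub>R v) - r * ?L v\<bar> \<le> 2 * r * norm v * \<epsilon>"
      using 1 2 by (simp add: mult_ac)
  qed
  then show ?thesis by simp
qed

lemma linear_directional_derivative: "linear (directional_derivative F x)"
proof (rule linearI)
  let ?L = "directional_derivative F x"
  show add: "?L (v + w) = ?L v + ?L w" for v w by (rule directional_derivative_add)
  have zero: "?L 0 = 0" using add[of 0 0] by simp
  have neg: "?L (- v) = - ?L v" for v using add[of v "- v"] zero by simp
  show "?L (r *\<^sub>R v) = r *\<^sub>R ?L v" for r v
  proof -
    consider "0 < r" | "r = 0" | "0 < - r" by linarith
    then show ?thesis
    proof cases
      case 1 then show ?thesis by (simp add: directional_derivative_scale_pos)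
    next
      case 2 then show ?thesis by (simp add: zero)
    next
      case 3
      have "?L (r *\<^sub>R v) = ?L ((- r) *\<^sub>R (- v))" by simp
      also have "\<dots> = (- r) * ?L (- v)" by (rule directional_derivative_scale_pos[OF 3])
      finally show ?thesis by (simp add: neg)
    qed
  qed
qed

text \<open>
  Semiconvexity and semiconcavity alone do not give continuity: every discontinuous linear
  functional has both properties. Boundedness on one ball excludes this.
\<close>

lemma bounded_linear_directional_derivative:
  assumes bdd: "bounded (F ` cball x (\<delta> 1))"
  shows "bounded_linear (directional_derivative F x)"
proof -
  let ?L = "directional_derivative F x"
  obtain B where B: "\<And>y. y \<in> cball x (\<delta> 1) \<Longrightarrow> \<bar>F y\<bar> \<le> B"
    using bdd unfolding bounded_iff real_norm_def by blast
  have d: "0 < \<delta> 1" by (rule gauge_pos) simp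
  have "norm (?L v) \<le> norm v * ((2 * B + \<delta> 1) / \<delta> 1)" for v
  proof (cases "v = 0")
    case True
    then show ?thesis using linear_0[OF linear_directional_derivative] by simp
  next
    case False
    define w where "w = (\<delta> 1 / norm v) *\<^sub>R v"
    have nw: "norm w = \<delta> 1" unfolding w_def using False d by simp
    have "\<bar>F (x + w) - F x - ?L w\<bar> \<le> 1 * norm w"
      by (rule directional_derivative_approx) (simp_all add: nw)
    moreover have "\<bar>F (x + w)\<bar> \<le> B" "\<bar>F x\<bar> \<le> B" using nw d by (auto intro!: B simp: dist_norm)
    ultimately have "\<bar>?L w\<bar> \<le> 2 * B + \<delta> 1" using nw by linarith
    moreover have "?L w = (\<delta> 1 / norm v) * ?L v"
      unfolding w_def using linear_cmul[OF linear_directional_derivative] by simp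
    ultimately have "\<delta> 1 / norm v * \<bar>?L v\<bar> \<le> 2 * B + \<delta> 1" using d by (simp add: abs_mult)
    then show ?thesis using d False by (simp add: field_simps)
  qed
  then show ?thesis
    by (intro bounded_linear_intro[where K = "(2 * B + \<delta> 1) / \<delta> 1"])
       (auto simp: linear_add[OF linear_directional_derivative] linear_cmul[OF linear_directional_derivative])
qed

text \<open>
  Take \<open>w\<close> parallel to \<open>v\<close> with \<open>\<parallel>w\<parallel> = \<parallel>x - y\<parallel>\<close>. In the parallelogram \<open>x, x + w, y + w, y\<close> both
  diagonals have the same midpoint and length at most \<open>2 \<parallel>x - y\<parallel>\<close>, so the increments of \<open>F\<close>
  along its two sides parallel to \<open>w\<close> almost agree; they determine the derivatives in direction
  \<open>w\<close> up to the same order.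
\<close>

lemma directional_derivative_uniformly_continuous:
  assumes \<epsilon>: "0 < \<epsilon>" and xy: "2 * norm (x - y) \<le> \<delta> \<epsilon>"
  shows "\<bar>directional_derivative F x v - directional_derivative F y v\<bar> \<le> 4 * \<epsilon> * norm v"
proof (cases "v = 0 \<or> x = y")
  case True
  then show ?thesis using \<epsilon> linear_0[OF linear_directional_derivative] by auto
next
  case False
  let ?L = "directional_derivative F"
  define d where "d = norm (x - y)"
  have d: "0 < d" using False by (simp add: d_def)
  define s where "s = d / norm v"
  have s: "0 < s" using False d by (simp add: s_def)
  define w where "w = s *\<^sub>R v"
  have nw: "norm w = d" unfolding w_def s_def using False d by simp
  have "2 * d \<le> \<delta> \<epsilon>" using xy by (simp add: d_def)
  then have small: "norm w \<le> \<delta> \<epsilon>" using nw d by linarith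
  have Lx: "\<bar>F (x + w) - F x - ?L x w\<bar> \<le> \<epsilon> * d" and Ly: "\<bar>F (y + w) - F y - ?L y w\<bar> \<le> \<epsilon> * d"
    using directional_derivative_approx[OF \<epsilon> small] nw by simp_all
  have n1: "norm (x + w - y) \<le> 2 * d" and n2: "norm (y + w - x) \<le> 2 * d"
    using norm_triangle_ineq[of "x - y" w] norm_triangle_ineq[of "y - x" w] nw
    by (simp_all add: d_def algebra_simps norm_minus_commute)
  have m1: "\<bar>F (x + w) + F y - 2 * F ((1/2) *\<^sub>R (x + w + y))\<bar> \<le> \<epsilon> * d"
    using midpoint_bound[OF F minus_F \<epsilon>, of "x + w" y] n1 \<open>2 * d \<le> \<delta> \<epsilon>\<close>
      mult_left_mono[OF n1, of \<epsilon>] \<epsilon> by linarith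
  have m2: "\<bar>F (y + w) + F x - 2 * F ((1/2) *\<^sub>R (y + w + x))\<bar> \<le> \<epsilon> * d"
    using midpoint_bound[OF F minus_F \<epsilon>, of "y + w" x] n2 \<open>2 * d \<le> \<delta> \<epsilon>\<close>
      mult_left_mono[OF n2, of \<epsilon>] \<epsilon> by linarith
  have eq: "y + w + x = x + w + y" by simp
  have "\<bar>?L x w - ?L y w\<bar> \<le> 4 * (\<epsilon> * d)" using Lx Ly m1 m2[unfolded eq] by linarith
  moreover have "?L x w - ?L y w = s * (?L x v - ?L y v)"
    unfolding w_def using linear_cmul[OF linear_directional_derivative] by (simp add: algebra_simps)
  moreover have "s * norm v = d" using False by (simp add: s_def)
  then have "4 * (\<epsilon> * d) = s * (4 * \<epsilon> * norm v)" by (simp add: mult_ac flip: \<open>s * norm v = d\<close>)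
  ultimately have "s * \<bar>?L x v - ?L y v\<bar> \<le> s * (4 * \<epsilon> * norm v)"
    using s by (simp add: abs_mult)
  then show ?thesis using s by (simp only: mult_le_cancel_left_pos)
qed

lemma semiconvex_semiconcave_C1_plus:
  assumes bdd: "\<And>x r. bounded (F ` cball x r)"
  shows "F C1_plus_on UNIV"
  unfolding C1_plus_on_def
proof (intro exI[of _ "\<lambda>x. Blinfun (directional_derivative F x)"] conjI ballI)
  have app: "blinfun_apply (Blinfun (directional_derivative F x)) = directional_derivative F x" for x
    by (rule bounded_linear_Blinfun_apply[OF bounded_linear_directional_derivative[OF bdd]])
  show "(F has_derivative blinfun_apply (Blinfun (directional_derivative F x))) (at x)" for x
    unfolding app has_derivative_at_alt
  proof (intro conjI allI impI)
    show "bounded_linear (directional_derivative F x)"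
      by (rule bounded_linear_directional_derivative[OF bdd])
    fix e :: real assume e: "0 < e"
    show "\<exists>d>0. \<forall>y. norm (y - x) < d \<longrightarrow>
        norm (F y - F x - directional_derivative F x (y - x)) \<le> e * norm (y - x)"
    proof (intro exI[of _ "\<delta> e"] conjI allI impI)
      show "0 < \<delta> e" by (rule gauge_pos[OF e])
      fix y assume "norm (y - x) < \<delta> e"
      then show "norm (F y - F x - directional_derivative F x (y - x)) \<le> e * norm (y - x)"
        using directional_derivative_approx[OF e, of "y - x" x] by simp
    qed
  qed
  show "uniformly_continuous_on UNIV (\<lambda>x. Blinfun (directional_derivative F x))"
    unfolding uniformly_continuous_on_def
  proof (intro allI impI)
    fix e :: real assume e: "0 < e"
    then have e8: "0 < e / 8" by simp
    show "\<exists>d>0. \<forall>x\<in>UNIV. \<forall>x'\<in>UNIV. dist x' x < d \<longrightarrow>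
        dist (Blinfun (directional_derivative F x')) (Blinfun (directional_derivative F x)) < e"
    proof (intro exI[of _ "\<delta> (e/8) / 2"] conjI ballI impI)
      show "0 < \<delta> (e/8) / 2" using gauge_pos[OF e8] by simp
      fix x x' :: 'a assume "dist x' x < \<delta> (e/8) / 2"
      then have "2 * norm (x' - x) \<le> \<delta> (e/8)" by (simp add: dist_norm)
      then have "norm (Blinfun (directional_derivative F x') - Blinfun (directional_derivative F x)) \<le> e / 2"
        using directional_derivative_uniformly_continuous[OF e8, of x' x] e
        by (intro norm_blinfun_bound) (auto simp: blinfun.diff_left app)
      then show "dist (Blinfun (directional_derivative F x')) (Blinfun (directional_derivative F x)) < e"
        using e by (simp add: dist_norm)
    qed
  qed
qed

end

section \<open>Uniformly smooth convex functions\<close>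

text \<open>
  For convex functions it is enough to control symmetric second differences, which for a norm are
  what the modulus of smoothness measures.
\<close>

definition uniformly_smooth_convex :: "('a::real_normed_vector \<Rightarrow> real) \<Rightarrow> bool" where
  "uniformly_smooth_convex \<phi> \<longleftrightarrow>
     \<phi> 0 = 0 \<and> (\<forall>x. 0 \<le> \<phi> x) \<and> convex_on UNIV \<phi> \<and> (\<forall>x r. bounded (\<phi> ` cball x r)) \<and>
     (\<forall>\<epsilon>>0. \<exists>\<delta>>0. \<forall>x h. norm h \<le> \<delta> \<longrightarrow> \<phi> (x + h) + \<phi> (x - h) - 2 * \<phi> x \<le> \<epsilon> * norm h)"

text \<open>
  Let \<open>t \<le> 1/2\<close> and \<open>z = t x + (1 - t) y\<close>. Reflecting \<open>x\<close> at \<open>z\<close> gives a point beyond \<open>y\<close>, and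
  convexity bounds \<open>\<phi> y\<close> by a mean of \<open>\<phi> z\<close> and the value at the reflected point. Thus the
  left-hand side is at most \<open>t\<close> times a symmetric second difference at \<open>z\<close>. The factor 2 pays for
  replacing \<open>t\<close> by \<open>t (1 - t)\<close>.
\<close>

lemma second_difference_imp_semiconcave:
  fixes \<phi> :: "'a::real_normed_vector \<Rightarrow> real"
  assumes conv: "convex_on UNIV \<phi>" and e: "0 < \<epsilon>"
    and sd: "\<And>x h. norm h \<le> \<delta> \<Longrightarrow> \<phi> (x + h) + \<phi> (x - h) - 2 * \<phi> x \<le> \<epsilon> * norm h"
    and xy: "norm (x - y) \<le> \<delta>" and t: "0 \<le> t" "t \<le> 1"
  shows "t * \<phi> x + (1 - t) * \<phi> y - \<phi> (t *\<^sub>R x + (1 - t) *\<^sub>R y) \<le> t * (1 - t) * (2 * \<epsilon>) * norm (x - y)"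
proof -
  have half: "t * \<phi> x + (1 - t) * \<phi> y - \<phi> (t *\<^sub>R x + (1 - t) *\<^sub>R y) \<le> t * (1 - t) * (2 * \<epsilon>) * norm (x - y)"
    if xy: "norm (x - y) \<le> \<delta>" and t: "0 \<le> t" "t \<le> 1/2" for x y t
  proof -
    define z where "z = t *\<^sub>R x + (1 - t) *\<^sub>R y"
    define h where "h = (1 - t) *\<^sub>R (x - y)"
    have zx: "z + h = x" by (simp add: z_def h_def algebra_simps)
    have nh: "norm h \<le> norm (x - y)" using t by (simp add: h_def mult_left_le_one_le)
    define \<mu> where "\<mu> = t / (1 - t)"
    have \<mu>: "0 \<le> \<mu>" "\<mu> \<le> 1" "(1 - t) * \<mu> = t" using t by (auto simp: \<mu>_def)
    have "(1 - \<mu>) *\<^sub>R z + \<mu> *\<^sub>R (z - h) = z - ((1 - t) * \<mu>) *\<^sub>R (x - y)"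
      by (simp add: h_def algebra_simps)
    also have "\<dots> = y" unfolding \<mu>(3) by (simp add: z_def algebra_simps)
    finally have "(1 - \<mu>) *\<^sub>R z + \<mu> *\<^sub>R (z - h) = y" .
    then have "\<phi> y \<le> (1 - \<mu>) * \<phi> z + \<mu> * \<phi> (z - h)"
      using convex_onD[OF conv \<mu>(1,2), of z "z - h"] by simp
    then have "(1 - t) * \<phi> y \<le> (1 - t) * ((1 - \<mu>) * \<phi> z + \<mu> * \<phi> (z - h))"
      using t by (intro mult_left_mono) auto
    also have "\<dots> = ((1 - t) - (1 - t) * \<mu>) * \<phi> z + ((1 - t) * \<mu>) * \<phi> (z - h)"
      by (simp add: algebra_simps)
    finally have "t * \<phi> x + (1 - t) * \<phi> y - \<phi> z \<le> t * (\<phi> (z + h) + \<phi> (z - h) - 2 * \<phi> z)"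
      unfolding \<mu>(3) zx by (simp add: algebra_simps)
    also have "\<dots> \<le> t * (\<epsilon> * norm h)" using t nh xy by (intro mult_left_mono sd) auto
    also have "\<dots> \<le> t * (\<epsilon> * norm (x - y))" using t nh e by (intro mult_left_mono) auto
    also have "\<dots> = t * (1/2) * (2 * \<epsilon>) * norm (x - y)" by simp
    also have "\<dots> \<le> t * (1 - t) * (2 * \<epsilon>) * norm (x - y)"
      using t e by (intro mult_right_mono mult_left_mono) auto
    finally show ?thesis by (simp add: z_def)
  qed
  show ?thesis
  proof (cases "t \<le> 1/2")
    case True
    then show ?thesis using half xy t by blast
  next
    case False
    then show ?thesis
      using half[of y x "1 - t"] xy t by (simp add: norm_minus_commute algebra_simps)
  qed
qed

lemma uniformly_smooth_convex_imp_semiconcave: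
  assumes "uniformly_smooth_convex \<phi>"
  obtains \<delta> where "\<And>\<epsilon>. 0 < \<epsilon> \<Longrightarrow> 0 < \<delta> \<epsilon>" "semiconvex_gauge \<delta> (\<lambda>x. - \<phi> x)"
proof -
  have "\<forall>\<epsilon>. \<exists>\<delta>. 0 < \<epsilon> \<longrightarrow> 0 < \<delta> \<and>
      (\<forall>x h. norm h \<le> \<delta> \<longrightarrow> \<phi> (x + h) + \<phi> (x - h) - 2 * \<phi> x \<le> (\<epsilon> / 2) * norm h)"
    using assms unfolding uniformly_smooth_convex_def by (metis half_gt_zero)
  then obtain \<delta> where \<delta>: "\<And>\<epsilon>. 0 < \<epsilon> \<Longrightarrow> 0 < \<delta> \<epsilon>"
    "\<And>\<epsilon> x h. 0 < \<epsilon> \<Longrightarrow> norm h \<le> \<delta> \<epsilon> \<Longrightarrow> \<phi> (x + h) + \<phi> (x - h) - 2 * \<phi> x \<le> (\<epsilon> / 2) * norm h"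
    by metis
  have conv: "convex_on UNIV \<phi>" using assms by (simp add: uniformly_smooth_convex_def)
  have "semiconvex_gauge \<delta> (\<lambda>x. - \<phi> x)"
    unfolding semiconvex_gauge_def
  proof (intro allI impI ballI)
    fix \<epsilon> t :: real and x y :: 'a
    assume *: "0 < \<epsilon>" "norm (x - y) \<le> \<delta> \<epsilon>" "t \<in> {0..1}"
    show "- \<phi> (t *\<^sub>R x + (1 - t) *\<^sub>R y) \<le> t * - \<phi> x + (1 - t) * - \<phi> y + t * (1 - t) * \<epsilon> * norm (x - y)"
      using second_difference_imp_semiconcave[OF conv _ \<delta>(2)[OF *(1)] *(2), of t] * by simp
  qed
  then show thesis using that \<delta>(1) by blast
qed

lemma uniformly_smooth_convex_combination:
  fixes f g :: "'a::real_normed_vector \<Rightarrow> real"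
  assumes f: "uniformly_smooth_convex f" and g: "uniformly_smooth_convex g" and ab: "0 \<le> a" "0 \<le> b"
  shows "uniformly_smooth_convex (\<lambda>x. a * f x + b * g x)"
  unfolding uniformly_smooth_convex_def
proof (intro conjI allI impI)
  show "a * f 0 + b * g 0 = 0"
    using f g by (simp add: uniformly_smooth_convex_def)
  show "0 \<le> a * f x + b * g x" for x
    using f g ab by (simp add: uniformly_smooth_convex_def)
  show "convex_on UNIV (\<lambda>x. a * f x + b * g x)"
    using f g ab by (intro convex_on_add convex_on_cmul) (auto simp: uniformly_smooth_convex_def)
  show "bounded ((\<lambda>x. a * f x + b * g x) ` cball x r)" for x r
  proof -
    have "bounded ((\<lambda>x. a *\<^sub>R f x + b *\<^sub>R g x) ` cball x r)"
      using f g unfolding uniformly_smooth_convex_def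
      by (intro bounded_plus_comp bounded_scaleR_comp) auto
    then show ?thesis by simp
  qed
  fix \<epsilon> :: real assume e: "0 < \<epsilon>"
  define e' where "e' = \<epsilon> / (a + b + 1)"
  have e': "0 < e'" "(a + b) * e' \<le> \<epsilon>" using e ab by (simp_all add: e'_def divide_simps mult_left_mono)
  obtain d1 where d1: "0 < d1" "\<And>x h. norm h \<le> d1 \<Longrightarrow> f (x + h) + f (x - h) - 2 * f x \<le> e' * norm h"
    using f e'(1) unfolding uniformly_smooth_convex_def by meson
  obtain d2 where d2: "0 < d2" "\<And>x h. norm h \<le> d2 \<Longrightarrow> g (x + h) + g (x - h) - 2 * g x \<le> e' * norm h"
    using g e'(1) unfolding uniformly_smooth_convex_def by meson
  show "\<exists>\<delta>>0. \<forall>x h. norm h \<le> \<delta> \<longrightarrow> a * f (x + h) + b * g (x + h) + (a * f (x - h) + b * g (x - h))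
      - 2 * (a * f x + b * g x) \<le> \<epsilon> * norm h"
  proof (intro exI[of _ "min d1 d2"] conjI allI impI)
    show "0 < min d1 d2" using d1(1) d2(1) by simp
    fix x h :: 'a assume "norm h \<le> min d1 d2"
    then have "a * (f (x + h) + f (x - h) - 2 * f x) \<le> a * (e' * norm h)"
      "b * (g (x + h) + g (x - h) - 2 * g x) \<le> b * (e' * norm h)"
      using ab by (auto intro!: mult_left_mono d1(2) d2(2))
    moreover have "a * (e' * norm h) + b * (e' * norm h) \<le> \<epsilon> * norm h"
      using mult_right_mono[OF e'(2), of "norm h"] by (simp add: algebra_simps)
    ultimately show "a * f (x + h) + b * g (x + h) + (a * f (x - h) + b * g (x - h))
      - 2 * (a * f x + b * g x) \<le> \<epsilon> * norm h"
      by (simp add: algebra_simps)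
  qed
qed

section \<open>Building blocks from an equivalent norm\<close>

lemma equivalent_norm_abs_diff:
  assumes "equivalent_norm N"
  shows "\<bar>N (x + h) - N x\<bar> \<le> N h"
proof -
  have N: "\<And>x y. N (x + y) \<le> N x + N y" "\<And>a x. N (a *\<^sub>R x) = \<bar>a\<bar> * N x"
    using assms by (auto simp: equivalent_norm_def)
  have "N (- h) = N h" using N(2)[of "-1" h] by simp
  then show ?thesis using N(1)[of x h] N(1)[of "x + h" "- h"] by simp
qed

lemma equivalent_norm_convex:
  assumes "equivalent_norm N"
  shows "convex_on UNIV N"
proof (rule convex_onI)
  fix t :: real and x y assume "0 < t" "t < 1"
  moreover have N: "\<And>x y. N (x + y) \<le> N x + N y" "\<And>a x. N (a *\<^sub>R x) = \<bar>a\<bar> * N x"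
    using assms by (auto simp: equivalent_norm_def)
  ultimately show "N ((1 - t) *\<^sub>R x + t *\<^sub>R y) \<le> (1 - t) * N x + t * N y"
    using N(1)[of "(1 - t) *\<^sub>R x" "t *\<^sub>R y"] by simp
qed auto

text \<open>
  The modulus speaks of unit vectors; dividing \<open>x\<close> and \<open>h\<close> by their norms reduces the general case
  to it. The set whose supremum is the modulus is bounded above by \<open>\<tau>\<close>, so the supremum dominates
  its members.
\<close>

lemma second_difference_le_modulus:
  fixes N :: "'a::real_normed_vector \<Rightarrow> real"
  assumes N: "equivalent_norm N" and x: "0 < N x"
  shows "N (x + h) + N (x - h) - 2 * N x \<le> 2 * N x * modulus_of_smoothness N (N h / N x)"
proof (cases "h = 0")
  case True
  have bdd: "bdd_above (insert 0 {(N (x + \<tau> *\<^sub>R y) + N (x - \<tau> *\<^sub>R y)) / 2 - 1 | x y. N x = 1 \<and> N y = 1})"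
    if "\<tau> = 0" for \<tau>
    using that by (intro bdd_aboveI[of _ 0]) auto
  have "N h = 0" using True N by (simp add: equivalent_norm_def)
  moreover have "0 \<le> modulus_of_smoothness N 0"
    unfolding modulus_of_smoothness_def using bdd by (intro cSup_upper) auto
  ultimately show ?thesis using True x by simp
next
  case False
  have Nax: "N 0 = 0" "\<And>x. N x = 0 \<Longrightarrow> x = 0" "\<And>x. 0 \<le> N x"
    "\<And>x y. N (x + y) \<le> N x + N y" "\<And>a x. N (a *\<^sub>R x) = \<bar>a\<bar> * N x"
    using N by (auto simp: equivalent_norm_def)
  have neg: "N (- y) = N y" for y using Nax(5)[of "-1" y] by simp
  have h: "0 < N h" using False Nax(2,3)[of h] by fastforce
  define \<tau> where "\<tau> = N h / N x"
  have \<tau>: "0 < \<tau>" using x h by (simp add: \<tau>_def)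
  let ?S = "{(N (u + \<tau> *\<^sub>R v) + N (u - \<tau> *\<^sub>R v)) / 2 - 1 | u v. N u = 1 \<and> N v = 1}"
  have "bdd_above (insert 0 ?S)"
  proof (rule bdd_aboveI[of _ "\<tau>"])
    fix s assume "s \<in> insert 0 ?S"
    then consider "s = 0" | u v where "s = (N (u + \<tau> *\<^sub>R v) + N (u - \<tau> *\<^sub>R v)) / 2 - 1" "N u = 1" "N v = 1"
      by auto
    then show "s \<le> \<tau>"
    proof cases
      case 1 then show ?thesis using \<tau> by simp
    next
      case 2
      have "N (\<tau> *\<^sub>R v) = \<tau>" using 2(3) \<tau> by (simp add: Nax(5))
      then have "N (u + \<tau> *\<^sub>R v) \<le> 1 + \<tau>" "N (u - \<tau> *\<^sub>R v) \<le> 1 + \<tau>"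
        using Nax(4)[of u "\<tau> *\<^sub>R v"] Nax(4)[of u "- (\<tau> *\<^sub>R v)"] 2 neg[of "\<tau> *\<^sub>R v"] by simp_all
      then show ?thesis unfolding 2(1) by (simp add: field_simps)
    qed
  qed
  moreover
  define u where "u = (1 / N x) *\<^sub>R x"
  define v where "v = (1 / N h) *\<^sub>R h"
  have uv: "N u = 1" "N v = 1" using x h by (simp_all add: u_def v_def Nax(5))
  moreover have tv: "\<tau> *\<^sub>R v = (1 / N x) *\<^sub>R h" using h by (simp add: v_def \<tau>_def)
  ultimately have "(N (u + \<tau> *\<^sub>R v) + N (u - \<tau> *\<^sub>R v)) / 2 - 1 \<le> modulus_of_smoothness N \<tau>"
    unfolding modulus_of_smoothness_def by (intro cSup_upper) auto
  moreover have "u + \<tau> *\<^sub>R v = (1 / N x) *\<^sub>R (x + h)" "u - \<tau> *\<^sub>R v = (1 / N x) *\<^sub>R (x - h)"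
    unfolding tv u_def by (simp_all only: scaleR_add_right scaleR_diff_right)
  ultimately have "(N (x + h) / N x + N (x - h) / N x) / 2 - 1 \<le> modulus_of_smoothness N \<tau>"
    using x by (simp only: Nax(5)) simp
  then have "2 * N x * ((N (x + h) / N x + N (x - h) / N x) / 2 - 1) \<le> 2 * N x * modulus_of_smoothness N \<tau>"
    using x by (intro mult_left_mono) auto
  moreover have "2 * N x * ((N (x + h) / N x + N (x - h) / N x) / 2 - 1) = N (x + h) + N (x - h) - 2 * N x"
    using x by (simp add: field_simps)
  ultimately show ?thesis by (simp add: \<tau>_def)
qed

text \<open>
  The Huber function: its derivative \<open>min s 1\<close> vanishes at \<open>0\<close>, which smooths the vertex of a norm,
  and is bounded and Lipschitz.
\<close>

definition huber :: "real \<Rightarrow> real" where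
  "huber s = (if s \<le> 1 then s\<^sup>2 / 2 else s - 1/2)"

lemma huber_nonneg: "0 \<le> huber s"
  by (simp add: huber_def)

lemma huber_upper:
  assumes "0 \<le> s" "0 \<le> r"
  shows "huber r \<le> huber s + min s 1 * (r - s) + (r - s)\<^sup>2 / 2"
proof -
  have "s\<^sup>2/2 + s * (r - s) + (r - s)\<^sup>2/2 = r\<^sup>2/2" by (simp add: power2_eq_square field_simps)
  moreover have "r - 1/2 \<le> r\<^sup>2/2" using zero_le_power2[of "r - 1"] by (simp add: power2_eq_square algebra_simps)
  moreover have "r\<^sup>2/2 \<le> r - 1/2 + (r - s)\<^sup>2/2" if "r \<le> 1" "1 < s"
  proof -
    have "(1 - r)\<^sup>2 \<le> (s - r)\<^sup>2" using that by (intro power_mono) auto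
    then show ?thesis by (simp add: power2_eq_square field_simps)
  qed
  ultimately show ?thesis by (auto simp: huber_def min_def)
qed

lemma huber_lower:
  assumes "0 \<le> s" "0 \<le> r"
  shows "huber s + min s 1 * (r - s) \<le> huber r"
proof -
  have "s\<^sup>2/2 + s * (r - s) \<le> r\<^sup>2/2"
    using zero_le_power2[of "r - s"] by (simp add: power2_eq_square algebra_simps)
  moreover have "r - 1/2 \<le> r\<^sup>2/2" using zero_le_power2[of "r - 1"] by (simp add: power2_eq_square algebra_simps)
  moreover have "s\<^sup>2/2 + s * (r - s) \<le> r - 1/2" if "s \<le> 1" "1 < r"
  proof -
    have "s * (1 - s) + s * (r - 1) \<le> s * (1 - s) + 1 * (r - 1)" using that assms
      by (intro add_mono mult_right_mono) auto
    moreover have "s\<^sup>2/2 + s * (1 - s) \<le> 1/2"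
      using zero_le_power2[of "1 - s"] by (simp add: power2_eq_square algebra_simps)
    ultimately show ?thesis by (simp add: algebra_simps)
  qed
  ultimately show ?thesis by (auto simp: huber_def min_def)
qed

lemma huber_mono:
  assumes "0 \<le> s" "s \<le> r"
  shows "huber s \<le> huber r"
proof -
  have "0 \<le> min s 1 * (r - s)" using assms by (intro mult_nonneg_nonneg) auto
  then show ?thesis using huber_lower[of s r] assms by linarith
qed

lemma huber_diff_le:
  assumes "0 \<le> s" "0 \<le> r" "\<bar>r - s\<bar> \<le> t"
  shows "huber r - huber s \<le> t"
proof -
  have "min r 1 * (r - s) \<le> t"
  proof (cases "s \<le> r")
    case True
    then have "min r 1 * (r - s) \<le> 1 * (r - s)" by (intro mult_right_mono) auto
    also have "\<dots> \<le> t" using assms by simp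
    finally show ?thesis .
  next
    case False
    then have "min r 1 * (r - s) \<le> 0" using assms by (intro mult_nonneg_nonpos) auto
    also have "\<dots> \<le> t" using assms by simp
    finally show ?thesis .
  qed
  then show ?thesis using huber_lower[of r s] assms by (simp add: algebra_simps)
qed

lemma huber_ge_half:
  assumes "1 \<le> s" shows "s / 2 \<le> huber s"
  using assms by (auto simp: huber_def power2_eq_square)

lemma convex_on_huber_comp:
  assumes "convex_on UNIV N" "\<And>x. 0 \<le> N x"
  shows "convex_on UNIV (\<lambda>x. huber (N x))"
proof (rule convex_onI)
  fix t :: real and x y assume t: "0 < t" "t < 1"
  define m where "m = (1 - t) * N x + t * N y"
  have m: "0 \<le> m" using t assms by (simp add: m_def)
  have "N ((1 - t) *\<^sub>R x + t *\<^sub>R y) \<le> m"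
    unfolding m_def using t by (intro convex_onD[OF assms(1)]) auto
  then have "huber (N ((1 - t) *\<^sub>R x + t *\<^sub>R y)) \<le> huber m" using assms by (intro huber_mono) auto
  also have "huber m = (1 - t) * (huber m + min m 1 * (N x - m)) + t * (huber m + min m 1 * (N y - m))"
    by (simp add: m_def algebra_simps)
  also have "\<dots> \<le> (1 - t) * huber (N x) + t * huber (N y)"
    using t m assms by (intro add_mono mult_left_mono huber_lower) auto
  finally show "huber (N ((1 - t) *\<^sub>R x + t *\<^sub>R y)) \<le> (1 - t) * huber (N x) + t * huber (N y)" .
qed auto

lemma uniformly_smoothD:
  assumes "uniformly_smooth N" "0 < e"
  obtains k where "0 < k" "\<And>\<tau>. 0 < \<tau> \<Longrightarrow> \<tau> < k \<Longrightarrow> modulus_of_smoothness N \<tau> \<le> e * \<tau>"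
proof -
  have "eventually (\<lambda>\<tau>. modulus_of_smoothness N \<tau> / \<tau> < e) (at_right 0)"
    using assms unfolding uniformly_smooth_def by (rule order_tendstoD)
  then obtain k where "0 < k" "\<And>\<tau>. 0 < \<tau> \<Longrightarrow> \<tau> < k \<Longrightarrow> modulus_of_smoothness N \<tau> / \<tau> < e"
    unfolding eventually_at_right_field by auto
  then show thesis by (intro that[of k]) (auto simp: divide_simps intro: less_imp_le)
qed

text \<open>
  Put \<open>n = N x\<close> and \<open>t = N h\<close>. Up to \<open>t\<^sup>2\<close> the second difference is \<open>min n 1\<close>, the Huber derivative,
  times the second difference of \<open>N\<close>. If \<open>t\<close> is small compared with \<open>n\<close>, uniform smoothness bounds
  the latter by \<open>o(t)\<close>. Otherwise \<open>n\<close> is at most a constant times \<open>t\<close>, and the trivial bound \<open>2 t\<close>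
  already gives \<open>O(t\<^sup>2)\<close>.
\<close>

lemma huber_norm_second_difference:
  fixes N :: "'a::real_normed_vector \<Rightarrow> real"
  assumes N: "equivalent_norm N" and us: "uniformly_smooth N" and e: "0 < e"
  obtains d where "0 < d"
    "\<And>x h. N h \<le> d \<Longrightarrow> huber (N (x + h)) + huber (N (x - h)) - 2 * huber (N x) \<le> e * N h"
proof -
  have Nax: "\<And>x. 0 \<le> N x" "\<And>a x. N (a *\<^sub>R x) = \<bar>a\<bar> * N x" "N 0 = 0"
    using N by (auto simp: equivalent_norm_def)
  obtain k where k: "0 < k" "\<And>\<tau>. 0 < \<tau> \<Longrightarrow> \<tau> < k \<Longrightarrow> modulus_of_smoothness N \<tau> \<le> (e/4) * \<tau>"
    using uniformly_smoothD[OF us, of "e/4"] e by auto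
  define d where "d = min (e/2) (e * k / 4)"
  have d: "0 < d" "d \<le> e/2" "2 * d / k \<le> e/2" using e k(1) by (auto simp: d_def field_simps min_def)
  show thesis
  proof (rule that[OF d(1)])
    fix x h assume hd: "N h \<le> d"
    define n where "n = N x"
    define t where "t = N h"
    define a where "a = N (x + h) - n"
    define b where "b = N (x - h) - n"
    have n: "0 \<le> n" and t: "0 \<le> t" "t \<le> d" using Nax(1) hd by (auto simp: n_def t_def)
    have "N (- h) = t" using Nax(2)[of "-1" h] by (simp add: t_def)
    then have ab: "\<bar>a\<bar> \<le> t" "\<bar>b\<bar> \<le> t"
      using equivalent_norm_abs_diff[OF N, of x h] equivalent_norm_abs_diff[OF N, of x "- h"]
      by (simp_all add: a_def b_def n_def t_def)
    have sq: "a\<^sup>2 \<le> t * d" "b\<^sup>2 \<le> t * d"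
      using ab t mult_mono[of "\<bar>a\<bar>" t "\<bar>a\<bar>" d] mult_mono[of "\<bar>b\<bar>" t "\<bar>b\<bar>" d]
      by (auto simp: power2_eq_square abs_mult[symmetric])
    have main: "min n 1 * (a + b) \<le> (e/2) * t"
    proof (cases "0 < t \<and> t < k * n")
      case True
      then have n0: "0 < n" using k(1) n by (cases "n = 0") auto
      have "a + b \<le> 2 * n * modulus_of_smoothness N (t / n)"
        using second_difference_le_modulus[OF N, of x h] n0 by (simp add: a_def b_def n_def t_def)
      also have "\<dots> \<le> 2 * n * ((e/4) * (t / n))"
        using True n0 by (intro mult_left_mono k(2)) (auto simp: divide_simps)
      also have "\<dots> = (e/2) * t" using n0 by simp
      finally have "a + b \<le> (e/2) * t" .
      moreover have "0 \<le> (e/2) * t" using e t(1) by simp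
      moreover have "min n 1 * (a + b) \<le> (if 0 \<le> a + b then a + b else 0)"
        using n by (auto intro: mult_left_le_one_le mult_nonneg_nonpos)
      ultimately show ?thesis by (simp split: if_splits)
    next
      case False
      then consider "t = 0" | "k * n \<le> t" using t by linarith
      then show ?thesis
      proof cases
        case 1 then show ?thesis using ab by simp
      next
        case 2
        then have "n \<le> t / k" using k(1) by (simp add: field_simps)
        have "min n 1 * (a + b) \<le> min n 1 * (2 * t)" using n ab by (intro mult_left_mono) auto
        also have "\<dots> \<le> n * (2 * t)" using t by (intro mult_right_mono) auto
        also have "\<dots> \<le> (t / k) * (2 * t)" using \<open>n \<le> t / k\<close> t by (intro mult_right_mono) auto
        also have "\<dots> = (2 * t / k) * t" by simp
        also have "\<dots> \<le> (2 * d / k) * t" using t k(1) by (intro mult_right_mono divide_right_mono) auto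
        also have "\<dots> \<le> (e/2) * t" using d(3) t by (intro mult_right_mono) auto
        finally show ?thesis .
      qed
    qed
    have "huber (N (x + h)) \<le> huber n + min n 1 * a + a\<^sup>2 / 2"
      "huber (N (x - h)) \<le> huber n + min n 1 * b + b\<^sup>2 / 2"
      using huber_upper[of n "N (x + h)"] huber_upper[of n "N (x - h)"] n Nax(1)
      by (auto simp: a_def b_def)
    then have "huber (N (x + h)) + huber (N (x - h)) - 2 * huber n \<le> min n 1 * (a + b) + t * d"
      using sq by (simp add: algebra_simps)
    also have "\<dots> \<le> (e/2) * t + t * (e/2)" using main d(2) t by (intro add_mono mult_left_mono) auto
    finally show "huber (N (x + h)) + huber (N (x - h)) - 2 * huber (N x) \<le> e * N h"
      by (simp add: n_def t_def)
  qed
qed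


lemma convex_on_comp_scale:
  fixes f :: "'a::real_vector \<Rightarrow> real"
  assumes "convex_on UNIV f"
  shows "convex_on UNIV (\<lambda>v. f (r *\<^sub>R v))"
proof (rule convex_onI)
  fix t :: real and x y :: 'a assume t: "0 < t" "t < 1"
  have "f ((1 - t) *\<^sub>R (r *\<^sub>R x) + t *\<^sub>R (r *\<^sub>R y)) \<le> (1 - t) * f (r *\<^sub>R x) + t * f (r *\<^sub>R y)"
    using t by (intro convex_onD[OF assms]) auto
  moreover have "(1 - t) *\<^sub>R (r *\<^sub>R x) + t *\<^sub>R (r *\<^sub>R y) = r *\<^sub>R ((1 - t) *\<^sub>R x + t *\<^sub>R y)"
    by (simp add: algebra_simps)
  ultimately show "f (r *\<^sub>R ((1 - t) *\<^sub>R x + t *\<^sub>R y)) \<le> (1 - t) * f (r *\<^sub>R x) + t * f (r *\<^sub>R y)"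
    by simp
qed auto

lemma bounded_on_ball_if_dominated:
  fixes \<phi> :: "'a::real_normed_vector \<Rightarrow> real"
  assumes "\<And>v. 0 \<le> \<phi> v" "\<And>v. \<phi> v \<le> B * norm v ^ k" "0 \<le> B"
  shows "bounded (\<phi> ` cball x r)"
  unfolding bounded_iff
proof (intro exI ballI)
  fix s assume "s \<in> \<phi> ` cball x r"
  then obtain v where v: "s = \<phi> v" "norm (x - v) \<le> r" by (auto simp: dist_norm)
  have "norm v \<le> norm x + r" using v(2) norm_triangle_ineq4[of x "x - v"] by simp
  then have "B * norm v ^ k \<le> B * (norm x + r) ^ k"
    using assms(3) by (intro mult_left_mono power_mono) auto
  then show "norm s \<le> B * (norm x + r) ^ k" using assms(1)[of v] assms(2)[of v] v(1) by simp
qed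

text \<open>
  The Huber function of the norm, rescaled so that it dominates the given norm outside the unit
  ball. The last property, a bound for second differences that is valid at all scales, makes
  infinite superpositions converge.
\<close>

lemma smooth_convex_of_linear_growth:
  fixes N :: "'a::real_normed_vector \<Rightarrow> real"
  assumes N: "equivalent_norm N" and us: "uniformly_smooth N"
  obtains \<phi> :: "'a \<Rightarrow> real" and M where "0 < M" "uniformly_smooth_convex \<phi>"
    "\<And>v. \<phi> v \<le> M * norm v" "\<And>v. 1 \<le> norm v \<Longrightarrow> norm v \<le> \<phi> v"
    "\<And>x h. \<phi> (x + h) + \<phi> (x - h) - 2 * \<phi> x \<le> M * norm h"
proof -
  obtain c C where c: "0 < c" "0 < C" "\<And>x. c * norm x \<le> N x" "\<And>x. N x \<le> C * norm x"
    using N unfolding equivalent_norm_def by blast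
  have Nax: "\<And>x. 0 \<le> N x" "\<And>a x. N (a *\<^sub>R x) = \<bar>a\<bar> * N x"
    using N by (auto simp: equivalent_norm_def)
  have neg: "N (- h) = N h" for h using Nax(2)[of "-1" h] by simp
  define P where "P v = N ((1/c) *\<^sub>R v)" for v
  define K where "K = C / c"
  define \<phi> where "\<phi> v = 2 * huber (P v)" for v
  have K: "0 < K" using c by (simp add: K_def)
  have P: "norm v \<le> P v" "P v \<le> K * norm v" "0 \<le> P v" for v
    using c(3,4)[of "(1/c) *\<^sub>R v"] c(1) Nax(1) by (simp_all add: P_def K_def)
  have Pdiff: "\<bar>P (x + h) - P x\<bar> \<le> P h" "\<bar>P (x - h) - P x\<bar> \<le> P h" for x h
    using equivalent_norm_abs_diff[OF N, of "(1/c) *\<^sub>R x" "(1/c) *\<^sub>R h"]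
      equivalent_norm_abs_diff[OF N, of "(1/c) *\<^sub>R x" "- ((1/c) *\<^sub>R h)"]
    by (simp_all add: P_def scaleR_add_right scaleR_diff_right neg)
  have nonneg: "0 \<le> \<phi> v" for v by (simp add: \<phi>_def huber_nonneg)
  have lin: "\<phi> v \<le> 2 * K * norm v" for v
  proof -
    have "huber (P v) - huber 0 \<le> P v" using P by (intro huber_diff_le) auto
    then show ?thesis using P(2)[of v] by (simp add: \<phi>_def huber_def[of 0])
  qed
  have sd: "\<phi> (x + h) + \<phi> (x - h) - 2 * \<phi> x \<le> 4 * K * norm h" for x h
  proof -
    have "huber (P (x + h)) - huber (P x) \<le> P h" "huber (P (x - h)) - huber (P x) \<le> P h"
      using P Pdiff by (auto intro!: huber_diff_le)
    then show ?thesis using P(2)[of h] by (simp add: \<phi>_def)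
  qed
  have "uniformly_smooth_convex \<phi>"
    unfolding uniformly_smooth_convex_def
  proof (intro conjI allI impI)
    show "\<phi> 0 = 0" using nonneg[of 0] lin[of 0] by simp
    show "0 \<le> \<phi> x" for x by (rule nonneg)
    show "convex_on UNIV \<phi>"
      unfolding \<phi>_def[abs_def] P_def
      by (intro convex_on_cmul convex_on_huber_comp convex_on_comp_scale equivalent_norm_convex N Nax) simp
    show "bounded (\<phi> ` cball x r)" for x r
      by (rule bounded_on_ball_if_dominated[where k = 1 and B = "2 * K"]) (use nonneg lin K in auto)
    fix \<epsilon> :: real assume e: "0 < \<epsilon>"
    then have e': "0 < \<epsilon> / (2 * K)" using K by simp
    obtain d where d: "0 < d" "\<And>x h. N h \<le> d \<Longrightarrow>
        huber (N (x + h)) + huber (N (x - h)) - 2 * huber (N x) \<le> (\<epsilon> / (2 * K)) * N h"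
      using huber_norm_second_difference[OF N us e'] by blast
    show "\<exists>\<delta>>0. \<forall>x h. norm h \<le> \<delta> \<longrightarrow> \<phi> (x + h) + \<phi> (x - h) - 2 * \<phi> x \<le> \<epsilon> * norm h"
    proof (intro exI[of _ "d / K"] conjI allI impI)
      show "0 < d / K" using d K by simp
      fix x h :: 'a assume "norm h \<le> d / K"
      then have "P h \<le> d" using P(2)[of h] K by (simp add: field_simps)
      then have "huber (P (x + h)) + huber (P (x - h)) - 2 * huber (P x) \<le> (\<epsilon> / (2 * K)) * P h"
        using d(2)[of "(1/c) *\<^sub>R h" "(1/c) *\<^sub>R x"] by (simp add: P_def scaleR_add_right scaleR_diff_right)
      also have "\<dots> \<le> (\<epsilon> / (2 * K)) * (K * norm h)" using e' P(2) by (intro mult_left_mono) auto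
      also have "\<dots> = \<epsilon> / 2 * norm h" using K by simp
      finally show "\<phi> (x + h) + \<phi> (x - h) - 2 * \<phi> x \<le> \<epsilon> * norm h" by (simp add: \<phi>_def)
    qed
  qed
  moreover have "norm v \<le> \<phi> v" if "1 \<le> norm v" for v
  proof -
    have "norm v / 2 \<le> huber (norm v)" by (rule huber_ge_half[OF that])
    also have "\<dots> \<le> huber (P v)" using P by (intro huber_mono) auto
    finally show ?thesis by (simp add: \<phi>_def)
  qed
  moreover have "\<phi> v \<le> 4 * K * norm v" for v
    proof -
    have "2 * K * norm v \<le> 4 * K * norm v" using K by (intro mult_right_mono) auto
    then show ?thesis using lin[of v] by linarith
  qed
  ultimately show thesis using that[of "4 * K" \<phi>] K sd by simp
qed

text \<open>
  With \<open>n = N x\<close>, the second difference of \<open>N\<^sup>2\<close> is \<open>2 n\<close> times that of \<open>N\<close>, up to \<open>2 (N h)\<^sup>2\<close>.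
  Power type 2 bounds the second difference of \<open>N\<close> by \<open>2 K (N h)\<^sup>2 / n\<close>, so that \<open>n\<close> cancels.
\<close>

lemma smooth_convex_of_quadratic_growth:
  fixes N :: "'a::real_normed_vector \<Rightarrow> real"
  assumes N: "equivalent_norm N" and p: "smoothness_power_type N 2"
  obtains \<phi> :: "'a \<Rightarrow> real" where "uniformly_smooth_convex \<phi>" "\<And>v. norm v ^ 2 \<le> \<phi> v"
proof -
  obtain c C where c: "0 < c" "0 < C" "\<And>x. c * norm x \<le> N x" "\<And>x. N x \<le> C * norm x"
    using N unfolding equivalent_norm_def by blast
  obtain K where K: "0 < K" "\<And>\<tau>. 0 \<le> \<tau> \<Longrightarrow> modulus_of_smoothness N \<tau> \<le> K * \<tau> powr 2"
    using p unfolding smoothness_power_type_def by blast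
  have Nax: "\<And>x. 0 \<le> N x" "\<And>a x. N (a *\<^sub>R x) = \<bar>a\<bar> * N x" "N 0 = 0"
    using N by (auto simp: equivalent_norm_def)
  have neg: "N (- h) = N h" for h using Nax(2)[of "-1" h] by simp
  have sd: "N (x + h) ^ 2 + N (x - h) ^ 2 - 2 * N x ^ 2 \<le> (4 * K + 2) * N h ^ 2" for x h
  proof -
    define n where "n = N x"
    define t where "t = N h"
    define a where "a = N (x + h) - n"
    define b where "b = N (x - h) - n"
    have n: "0 \<le> n" and t: "0 \<le> t" using Nax(1) by (auto simp: n_def t_def)
    have ab: "\<bar>a\<bar> \<le> t" "\<bar>b\<bar> \<le> t"
      using equivalent_norm_abs_diff[OF N, of x h] equivalent_norm_abs_diff[OF N, of x "- h"]
      by (simp_all add: a_def b_def n_def t_def neg)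
    have sq: "a\<^sup>2 \<le> t\<^sup>2" "b\<^sup>2 \<le> t\<^sup>2" using ab by (auto intro: abs_le_square_iff[THEN iffD1] simp: t)
    have main: "2 * n * (a + b) \<le> 4 * K * t\<^sup>2"
    proof (cases "n = 0")
      case True
      then show ?thesis using K(1) by simp
    next
      case False
      then have n0: "0 < n" using n by simp
      have "a + b \<le> 2 * n * modulus_of_smoothness N (t / n)"
        using second_difference_le_modulus[OF N, of x h] n0 by (simp add: a_def b_def n_def t_def)
      also have "\<dots> \<le> 2 * n * (K * (t / n) powr 2)"
        using t n0 by (intro mult_left_mono K(2)) auto
      also have "\<dots> = 2 * n * (K * (t\<^sup>2 / n\<^sup>2))" using t n0 by (simp add: power_divide)
      finally have "2 * n * (a + b) \<le> 2 * n * (2 * n * (K * (t\<^sup>2 / n\<^sup>2)))"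
        using n0 by (intro mult_left_mono) auto
      also have "\<dots> = 4 * K * t\<^sup>2" using n0 by (simp add: power2_eq_square)
      finally show ?thesis .
    qed
    have "N (x + h) ^ 2 + N (x - h) ^ 2 - 2 * n ^ 2 = 2 * n * (a + b) + a\<^sup>2 + b\<^sup>2"
      by (simp add: a_def b_def power2_eq_square algebra_simps)
    also have "\<dots> \<le> (4 * K + 2) * t\<^sup>2" using main sq by (simp add: algebra_simps)
    finally show ?thesis by (simp add: n_def t_def)
  qed
  define q where "q = (4 * K + 2) * C\<^sup>2 / c\<^sup>2"
  have q: "0 < q" using K c by (simp add: q_def)
  define \<phi> where "\<phi> v = N v ^ 2 / c\<^sup>2" for v
  have upper: "\<phi> v \<le> (C\<^sup>2 / c\<^sup>2) * norm v ^ 2" for v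
  proof -
    have "N v ^ 2 \<le> (C * norm v) ^ 2" using c(4) Nax(1) by (intro power_mono) auto
    then show ?thesis using c(1) by (simp add: \<phi>_def power_mult_distrib divide_right_mono)
  qed
  have sd\<phi>: "\<phi> (x + h) + \<phi> (x - h) - 2 * \<phi> x \<le> q * norm h ^ 2" for x h
  proof -
    have "\<phi> (x + h) + \<phi> (x - h) - 2 * \<phi> x = (N (x + h) ^ 2 + N (x - h) ^ 2 - 2 * N x ^ 2) / c\<^sup>2"
      by (simp add: \<phi>_def diff_divide_distrib add_divide_distrib)
    also have "\<dots> \<le> (4 * K + 2) * N h ^ 2 / c\<^sup>2" using sd by (intro divide_right_mono) auto
    also have "\<dots> = (4 * K + 2) * \<phi> h" by (simp add: \<phi>_def)
    also have "\<dots> \<le> (4 * K + 2) * ((C\<^sup>2 / c\<^sup>2) * norm h ^ 2)"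
      using K(1) upper by (intro mult_left_mono) auto
    finally show ?thesis by (simp add: q_def)
  qed
  have "uniformly_smooth_convex \<phi>"
    unfolding uniformly_smooth_convex_def
  proof (intro conjI allI impI)
    show nonneg: "0 \<le> \<phi> x" for x by (simp add: \<phi>_def)
    show "\<phi> 0 = 0" by (simp add: \<phi>_def Nax(3))
    show "convex_on UNIV \<phi>"
    proof (rule convex_onI)
      fix t :: real and x y :: 'a assume t: "0 < t" "t < 1"
      have "N ((1 - t) *\<^sub>R x + t *\<^sub>R y) \<le> (1 - t) * N x + t * N y"
        using t by (intro convex_onD[OF equivalent_norm_convex[OF N]]) auto
      then have "N ((1 - t) *\<^sub>R x + t *\<^sub>R y) ^ 2 \<le> ((1 - t) * N x + t * N y) ^ 2"
        using Nax(1) by (intro power_mono) auto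
      also have "\<dots> = (1 - t) * N x ^ 2 + t * N y ^ 2 - t * (1 - t) * (N x - N y) ^ 2"
        by (simp add: power2_eq_square algebra_simps)
      also have "\<dots> \<le> (1 - t) * N x ^ 2 + t * N y ^ 2" using t by simp
      finally have "N ((1 - t) *\<^sub>R x + t *\<^sub>R y) ^ 2 / c\<^sup>2 \<le> ((1 - t) * N x ^ 2 + t * N y ^ 2) / c\<^sup>2"
        by (intro divide_right_mono) auto
      then show "\<phi> ((1 - t) *\<^sub>R x + t *\<^sub>R y) \<le> (1 - t) * \<phi> x + t * \<phi> y"
        by (simp add: \<phi>_def add_divide_distrib)
    qed auto
    show "bounded (\<phi> ` cball x r)" for x r
      by (rule bounded_on_ball_if_dominated[OF nonneg upper]) auto
    fix \<epsilon> :: real assume e: "0 < \<epsilon>"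
    show "\<exists>\<delta>>0. \<forall>x h. norm h \<le> \<delta> \<longrightarrow> \<phi> (x + h) + \<phi> (x - h) - 2 * \<phi> x \<le> \<epsilon> * norm h"
    proof (intro exI[of _ "\<epsilon> / q"] conjI allI impI)
      show "0 < \<epsilon> / q" using e q by simp
      fix x h :: 'a assume "norm h \<le> \<epsilon> / q"
      then have "q * norm h \<le> \<epsilon>" using q by (simp add: field_simps)
      then have "q * norm h ^ 2 \<le> \<epsilon> * norm h"
        using mult_right_mono[of "q * norm h" \<epsilon> "norm h"] by (simp add: power2_eq_square mult.assoc)
      then show "\<phi> (x + h) + \<phi> (x - h) - 2 * \<phi> x \<le> \<epsilon> * norm h" using sd\<phi>[of x h] by linarith
    qed
  qed
  moreover have "norm v ^ 2 \<le> \<phi> v" for v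
  proof -
    have "(c * norm v) ^ 2 \<le> N v ^ 2" using c by (intro power_mono) auto
    then show ?thesis using c(1) by (simp add: \<phi>_def power_mult_distrib field_simps)
  qed
  ultimately show thesis using that by blast
qed

text \<open>
  \<open>\<psi> v = (\<Sum>k. 2\<^sup>-\<^sup>k d\<^sub>k \<phi> (v / d\<^sub>k))\<close>. The \<open>k\<close>-th summand alone gives the lower bound from the scale
  \<open>d\<^sub>k\<close> on. The second difference of the \<open>k\<close>-th summand is at most \<open>2\<^sup>-\<^sup>k M \<parallel>h\<parallel>\<close>, and for fixed \<open>k\<close> it
  is \<open>o(\<parallel>h\<parallel>)\<close>; so the tail of the series is small compared with \<open>\<parallel>h\<parallel>\<close> for all \<open>h\<close>, and finitely many
  summands remain.
\<close>

lemma superposition_of_scales: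
  fixes \<phi> :: "'a::real_normed_vector \<Rightarrow> real" and d :: "nat \<Rightarrow> real"
  assumes M: "0 < M" and \<phi>: "uniformly_smooth_convex \<phi>"
    and lin: "\<And>v. \<phi> v \<le> M * norm v" and big: "\<And>v. 1 \<le> norm v \<Longrightarrow> norm v \<le> \<phi> v"
    and sd: "\<And>x h. \<phi> (x + h) + \<phi> (x - h) - 2 * \<phi> x \<le> M * norm h"
    and d: "\<And>k. 0 < d k"
  obtains \<psi> :: "'a \<Rightarrow> real" where "uniformly_smooth_convex \<psi>"
    "\<And>k v. d k \<le> norm v \<Longrightarrow> (1/2) ^ k * norm v \<le> \<psi> v"
proof -
  define u where "u k v = (1/2) ^ k * (d k * \<phi> ((1 / d k) *\<^sub>R v))" for k v
  define \<psi> where "\<psi> v = (\<Sum>k. u k v)" for v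
  have conv: "convex_on UNIV \<phi>" using \<phi> by (simp add: uniformly_smooth_convex_def)
  have u0: "0 \<le> u k v" for k v
    using \<phi> d[of k] by (simp add: u_def uniformly_smooth_convex_def)
  have ulin: "u k v \<le> (1/2) ^ k * (M * norm v)" for k v
  proof -
    have "d k * \<phi> ((1 / d k) *\<^sub>R v) \<le> d k * (M * norm ((1 / d k) *\<^sub>R v))"
      using d[of k] by (intro mult_left_mono lin) auto
    also have "\<dots> = M * norm v" using d[of k] by simp
    finally show ?thesis unfolding u_def by (intro mult_left_mono) auto
  qed
  have geo: "summable (\<lambda>k. (1/2::real) ^ k * B)" "(\<Sum>k. (1/2::real) ^ k * B) = 2 * B" for B
    using summable_mult2[OF summable_geometric, of "1/2::real" B]
      suminf_mult2[OF summable_geometric, of "1/2::real" B, symmetric] suminf_geometric[of "1/2::real"]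
    by (simp_all add: mult.commute)
  have summ: "summable (\<lambda>k. u k v)" for v
    by (rule summable_comparison_test'[OF geo(1)[of "M * norm v"], of 0]) (use u0 ulin in auto)
  have \<psi>0: "0 \<le> \<psi> v" for v unfolding \<psi>_def by (rule suminf_nonneg[OF summ u0])
  have \<psi>lin: "\<psi> v \<le> 2 * M * norm v" for v
    proof -
    have "\<psi> v \<le> (\<Sum>k. (1/2) ^ k * (M * norm v))"
      unfolding \<psi>_def by (intro suminf_le ulin summ geo(1))
    then show ?thesis using geo(2)[of "M * norm v"] by simp
  qed
  have usd: "u k (x + h) + u k (x - h) - 2 * u k x \<le> (1/2) ^ k * (e * norm h)"
    if e: "\<And>y g. norm g = norm h / d k \<Longrightarrow> \<phi> (y + g) + \<phi> (y - g) - 2 * \<phi> y \<le> e * norm g" for k x h e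
  proof -
    let ?y = "(1 / d k) *\<^sub>R x" and ?g = "(1 / d k) *\<^sub>R h"
    have "u k (x + h) + u k (x - h) - 2 * u k x = (1/2) ^ k * (d k * (\<phi> (?y + ?g) + \<phi> (?y - ?g) - 2 * \<phi> ?y))"
      by (simp add: u_def scaleR_add_right scaleR_diff_right right_diff_distrib distrib_left)
    also have "\<dots> \<le> (1/2) ^ k * (d k * (e * norm ?g))"
      using d[of k] by (intro mult_left_mono e) auto
    also have "\<dots> = (1/2) ^ k * (e * norm h)" using d[of k] by simp
    finally show ?thesis .
  qed
  have \<psi>sd: "\<psi> (x + h) + \<psi> (x - h) - 2 * \<psi> x = (\<Sum>k. u k (x + h) + u k (x - h) - 2 * u k x)"
    and sdsumm: "summable (\<lambda>k. u k (x + h) + u k (x - h) - 2 * u k x)" for x h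
  proof -
    have "(\<lambda>k. u k (x + h) + u k (x - h) - 2 * u k x) sums (\<psi> (x + h) + \<psi> (x - h) - 2 * \<psi> x)"
      unfolding \<psi>_def by (intro sums_diff sums_add sums_mult summable_sums summ)
    then show "\<psi> (x + h) + \<psi> (x - h) - 2 * \<psi> x = (\<Sum>k. u k (x + h) + u k (x - h) - 2 * u k x)"
      "summable (\<lambda>k. u k (x + h) + u k (x - h) - 2 * u k x)"
      by (auto simp: sums_iff)
  qed
  have "uniformly_smooth_convex \<psi>"
    unfolding uniformly_smooth_convex_def
  proof (intro conjI allI impI)
    show "\<psi> 0 = 0" using \<psi>0[of 0] \<psi>lin[of 0] by simp
    show "0 \<le> \<psi> x" for x by (rule \<psi>0)
    show "bounded (\<psi> ` cball x r)" for x r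
      by (rule bounded_on_ball_if_dominated[where k = 1 and B = "2 * M"]) (use \<psi>0 \<psi>lin M in auto)
    show "convex_on UNIV \<psi>"
    proof (rule convex_onI)
      fix t :: real and x y :: 'a assume t: "0 < t" "t < 1"
      have "u k ((1 - t) *\<^sub>R x + t *\<^sub>R y) \<le> (1 - t) * u k x + t * u k y" for k
      proof -
        have "convex_on UNIV (u k)"
          unfolding u_def using d[of k] by (intro convex_on_cmul convex_on_comp_scale conv) auto
        then show ?thesis using t by (intro convex_onD) auto
      qed
      then have "\<psi> ((1 - t) *\<^sub>R x + t *\<^sub>R y) \<le> (\<Sum>k. (1 - t) * u k x + t * u k y)"
        unfolding \<psi>_def by (intro suminf_le summ summable_add summable_mult)
      also have "\<dots> = (1 - t) * \<psi> x + t * \<psi> y"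
        unfolding \<psi>_def by (simp only: suminf_add[symmetric] suminf_mult summ summable_mult)
      finally show "\<psi> ((1 - t) *\<^sub>R x + t *\<^sub>R y) \<le> (1 - t) * \<psi> x + t * \<psi> y" .
    qed auto
    fix \<epsilon> :: real assume e: "0 < \<epsilon>"
    define e' where "e' = \<epsilon> / 4"
    have e': "0 < e'" using e by (simp add: e'_def)
    obtain d' where d': "0 < d'" "\<And>x h. norm h \<le> d' \<Longrightarrow> \<phi> (x + h) + \<phi> (x - h) - 2 * \<phi> x \<le> e' * norm h"
      using \<phi> e' unfolding uniformly_smooth_convex_def by meson
    obtain m where m: "(1/2::real) ^ m < \<epsilon> / (4 * M)"
      using real_arch_pow_inv[of "\<epsilon> / (4 * M)" "1/2"] e M by auto
    define D where "D = Min (insert 1 (d ` {..<m}))"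
    have D: "0 < D" "\<And>k. k < m \<Longrightarrow> D \<le> d k" using d by (auto simp: D_def)
    show "\<exists>\<delta>>0. \<forall>x h. norm h \<le> \<delta> \<longrightarrow> \<psi> (x + h) + \<psi> (x - h) - 2 * \<psi> x \<le> \<epsilon> * norm h"
    proof (intro exI[of _ "d' * D"] conjI allI impI)
      show "0 < d' * D" using D d' by simp
      fix x h :: 'a assume h: "norm h \<le> d' * D"
      let ?w = "\<lambda>k. u k (x + h) + u k (x - h) - 2 * u k x"
      have head: "?w k \<le> (1/2) ^ k * (e' * norm h)" if "k < m" for k
      proof (rule usd, rule d'(2))
        fix g :: 'a assume "norm g = norm h / d k"
        moreover have "norm h \<le> d' * d k"
          using h D(2)[OF that] mult_left_mono[of D "d k" d'] d'(1) by linarith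
        ultimately show "norm g \<le> d'" using d[of k] by (simp add: divide_le_eq)
      qed
      have tail: "?w (k + m) \<le> (1/2) ^ k * ((1/2) ^ m * (M * norm h))" for k
        using usd[OF sd, where k = "k + m" and x = x and h = h] by (simp add: power_add mult.assoc)
      have "(\<Sum>k. ?w k) = (\<Sum>k. ?w (k + m)) + (\<Sum>k<m. ?w k)"
        by (rule suminf_split_initial_segment[OF sdsumm])
      also have "(\<Sum>k. ?w (k + m)) \<le> (\<Sum>k. (1/2) ^ k * ((1/2) ^ m * (M * norm h)))"
        by (rule suminf_le[OF tail summable_ignore_initial_segment[OF sdsumm] geo(1)])
      also have "\<dots> = 2 * ((1/2) ^ m * (M * norm h))" by (rule geo(2))
      also have "\<dots> \<le> 2 * (\<epsilon> / (4 * M) * (M * norm h))"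
        using m M by (intro mult_left_mono mult_right_mono) auto
      also have "\<dots> = \<epsilon> / 2 * norm h" using M by simp
      also have "(\<Sum>k<m. ?w k) \<le> (\<Sum>k<m. (1/2) ^ k * (e' * norm h))"
        using head by (intro sum_mono) auto
      also have "\<dots> \<le> (\<Sum>k. (1/2) ^ k * (e' * norm h))"
        using e' by (intro sum_le_suminf geo(1)) auto
      also have "\<dots> = 2 * (e' * norm h)" by (rule geo(2))
      also have "\<dots> = \<epsilon> / 2 * norm h" by (simp add: e'_def)
      finally show "\<psi> (x + h) + \<psi> (x - h) - 2 * \<psi> x \<le> \<epsilon> * norm h"
        unfolding \<psi>sd by simp
    qed
  qed
  moreover have "(1/2) ^ k * norm v \<le> \<psi> v" if kv: "d k \<le> norm v" for k v
  proof -
    have "1 \<le> norm ((1 / d k) *\<^sub>R v)" using kv d[of k] by simp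
    then have "d k * norm ((1 / d k) *\<^sub>R v) \<le> d k * \<phi> ((1 / d k) *\<^sub>R v)"
      using d[of k] by (intro mult_left_mono big) auto
    then have "norm v \<le> d k * \<phi> ((1 / d k) *\<^sub>R v)" using d[of k] by simp
    then have "(1/2) ^ k * norm v \<le> u k v" unfolding u_def by (intro mult_left_mono) auto
    also have "\<dots> \<le> \<psi> v"
      unfolding \<psi>_def using sum_le_suminf[OF summ, of "{k}" v] u0 by simp
    finally show ?thesis .
  qed
  ultimately show thesis using that by blast
qed

section \<open>Estimates along curves in quasiconvex sets\<close>

text \<open>
  The length is used only through the sums over partitions, stated here for real numbers.
\<close>

lemma quasiconvex_with_curve:
  fixes U :: "'a::metric_space set"
  assumes qc: "quasiconvex_with c U" and c: "0 \<le> c" and xy: "x \<in> U" "y \<in> U"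
  obtains \<gamma> where "path \<gamma>" "path_image \<gamma> \<subseteq> U" "\<gamma> 0 = x" "\<gamma> 1 = y"
    "\<And>n t. mono_on {..n} t \<Longrightarrow> t ` {..n} \<subseteq> {0..1} \<Longrightarrow>
       (\<Sum>i<n. dist (\<gamma> (t i)) (\<gamma> (t (Suc i)))) \<le> c * dist x y"
proof -
  obtain \<gamma> where \<gamma>: "path \<gamma>" "path_image \<gamma> \<subseteq> U" "pathstart \<gamma> = x" "pathfinish \<gamma> = y"
    and len: "curve_length \<gamma> \<le> ennreal (c * dist x y)"
    using qc xy unfolding quasiconvex_with_def by blast
  have "(\<Sum>i<n. dist (\<gamma> (t i)) (\<gamma> (t (Suc i)))) \<le> c * dist x y"
    if "mono_on {..n} t" "t ` {..n} \<subseteq> {0..1}" for n t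
  proof -
    have "ennreal (\<Sum>i<n. dist (\<gamma> (t i)) (\<gamma> (t (Suc i)))) \<le> curve_length \<gamma>"
      unfolding curve_length_def
      by (rule SUP_upper2[of "(n, t)"]) (use that in auto)
    also note len
    finally show ?thesis using c by (subst (asm) ennreal_le_iff) auto
  qed
  then show thesis using that \<gamma> by (auto simp: pathstart_def pathfinish_def)
qed

lemma uniform_partition:
  fixes n :: nat
  assumes "0 < n"
  shows "mono_on {..n} (\<lambda>i. real i / real n)" "(\<lambda>i. real i / real n) ` {..n} \<subseteq> {0..1}"
  using assms by (auto intro!: mono_onI divide_right_mono simp: divide_le_eq)

lemma quasiconvex_curve_stays_close:
  fixes \<gamma> :: "real \<Rightarrow> 'a::metric_space"
  assumes len: "\<And>n t. mono_on {..n} t \<Longrightarrow> t ` {..n} \<subseteq> {0..1} \<Longrightarrow>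
       (\<Sum>i<n. dist (\<gamma> (t i)) (\<gamma> (t (Suc i)))) \<le> L"
    and s: "s \<in> {0..1}"
  shows "dist (\<gamma> 0) (\<gamma> s) \<le> L"
proof -
  let ?t = "\<lambda>i::nat. if i = 0 then 0 else s"
  have "(\<Sum>i<1. dist (\<gamma> (?t i)) (\<gamma> (?t (Suc i)))) \<le> L"
    using s by (intro len) (auto intro!: mono_onI)
  then show ?thesis by simp
qed

lemma path_fine_partition:
  assumes "path \<gamma>" "0 < r"
  obtains n where "0 < n"
    "\<And>i. i < n \<Longrightarrow> dist (\<gamma> (real i / real n)) (\<gamma> (real (Suc i) / real n)) < r"
proof -
  have "uniformly_continuous_on {0..1} \<gamma>"
    using assms(1) unfolding path_def by (intro compact_uniformly_continuous) auto
  then obtain d where d: "0 < d"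
    "\<And>s t. s \<in> {0..1} \<Longrightarrow> t \<in> {0..1} \<Longrightarrow> dist t s < d \<Longrightarrow> dist (\<gamma> t) (\<gamma> s) < r"
    using assms(2) unfolding uniformly_continuous_on_def by meson
  obtain m where m: "inverse (real (Suc m)) < d" using reals_Archimedean[OF d(1)] by auto
  show thesis
  proof (rule that[of "Suc m"])
    fix i assume "i < Suc m"
    show "dist (\<gamma> (real i / real (Suc m))) (\<gamma> (real (Suc i) / real (Suc m))) < r"
    proof (rule d(2))
      have "real (Suc i) / real (Suc m) - real i / real (Suc m) = inverse (real (Suc m))"
        by (simp add: field_simps)
      then show "dist (real i / real (Suc m)) (real (Suc i) / real (Suc m)) < d"
        using m by (subst dist_commute) (simp only: dist_real_def abs_inverse abs_of_nat)
    qed (use \<open>i < Suc m\<close> in \<open>auto simp: divide_le_eq\<close>)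
  qed simp
qed

text \<open>
  A mean value inequality along a curve that is only rectifiable. By compactness some \<open>\<rho>\<close> works
  for all points of the curve: the balls of radius \<open>\<rho>\<close> around them lie in \<open>U\<close> and the derivative
  there is at most \<open>M + \<epsilon>\<close>. The mean value inequality on these convex balls bounds the increment
  over each piece of a fine partition, and the chords add up to at most \<open>L\<close>.
\<close>

lemma increment_bound_along_curve:
  fixes g :: "'a::real_normed_vector \<Rightarrow> real" and g' :: "'a \<Rightarrow> 'a \<Rightarrow>\<^sub>L real"
  assumes U: "open U" and der: "\<And>u. u \<in> U \<Longrightarrow> (g has_derivative blinfun_apply (g' u)) (at u)"
    and uc: "uniformly_continuous_on U g'" and M: "0 \<le> M"
    and \<gamma>: "path \<gamma>" "path_image \<gamma> \<subseteq> U" and bd: "\<And>s. s \<in> {0..1} \<Longrightarrow> norm (g' (\<gamma> s)) \<le> M"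
    and len: "\<And>n t. mono_on {..n} t \<Longrightarrow> t ` {..n} \<subseteq> {0..1} \<Longrightarrow>
       (\<Sum>i<n. dist (\<gamma> (t i)) (\<gamma> (t (Suc i)))) \<le> L"
  shows "\<bar>g (\<gamma> 1) - g (\<gamma> 0)\<bar> \<le> M * L"
proof -
  have approx: "\<bar>g (\<gamma> 1) - g (\<gamma> 0)\<bar> \<le> (M + \<epsilon>) * L" if e: "0 < \<epsilon>" for \<epsilon>
  proof -
    have "\<exists>d>0. \<forall>v\<in>U. \<forall>u\<in>U. dist u v < d \<longrightarrow> dist (g' u) (g' v) < \<epsilon>"
      using uc e unfolding uniformly_continuous_on_def by simp
    then obtain d where d: "0 < d" "\<And>u v. u \<in> U \<Longrightarrow> v \<in> U \<Longrightarrow> dist u v < d \<Longrightarrow> dist (g' u) (g' v) < \<epsilon>"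
      by blast
    obtain r where r: "0 < r" "(\<Union>u\<in>path_image \<gamma>. ball u r) \<subseteq> U"
      by (rule compact_subset_open_imp_ball_epsilon_subset[OF compact_path_image[OF \<gamma>(1)] U \<gamma>(2)])
    define \<rho> where "\<rho> = min d r"
    have \<rho>: "0 < \<rho>" using d(1) r(1) by (simp add: \<rho>_def)
    obtain n where n: "0 < n"
      "\<And>i. i < n \<Longrightarrow> dist (\<gamma> (real i / real n)) (\<gamma> (real (Suc i) / real n)) < \<rho>"
      using path_fine_partition[OF \<gamma>(1) \<rho>] by blast
    define p where "p i = \<gamma> (real i / real n)" for i
    have step: "\<bar>g (p (Suc i)) - g (p i)\<bar> \<le> (M + \<epsilon>) * dist (p i) (p (Suc i))" if i: "i < n" for i
    proof -
      let ?B = "ball (p i) \<rho>"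
      have s: "real i / real n \<in> {0..1}" using i by (auto simp: divide_le_eq)
      have pi: "p i \<in> path_image \<gamma>" unfolding p_def path_image_def using s by (rule imageI)
      have B: "?B \<subseteq> U" using r(2) pi by (force simp: \<rho>_def)
      have mem: "p i \<in> ?B" "p (Suc i) \<in> ?B" using \<rho> n(2)[OF i] by (auto simp: p_def)
      have "norm (g (p (Suc i)) - g (p i)) \<le> (M + \<epsilon>) * norm (p (Suc i) - p i)"
      proof (rule differentiable_bound[OF convex_ball _ _ mem(2,1)])
        fix u assume u: "u \<in> ?B"
        then show "(g has_derivative blinfun_apply (g' u)) (at u within ?B)"
          using der B by (blast intro: has_derivative_at_withinI)
        have "dist (g' (p i)) (g' u) < \<epsilon>"
          using u mem(1) B by (intro d(2)) (auto simp: \<rho>_def)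
        moreover have "norm (g' (p i)) \<le> M" unfolding p_def by (rule bd[OF s])
        ultimately have "norm (g' u) \<le> M + \<epsilon>"
          using norm_triangle_ineq2[of "g' u" "g' (p i)"] by (simp add: dist_norm norm_minus_commute)
        then show "onorm (blinfun_apply (g' u)) \<le> M + \<epsilon>" by (simp add: norm_blinfun.rep_eq)
      qed
      then show ?thesis by (simp add: dist_norm norm_minus_commute)
    qed
    have "g (\<gamma> 1) - g (\<gamma> 0) = g (p n) - g (p 0)" using n(1) by (simp add: p_def)
    also have "\<dots> = (\<Sum>i<n. g (p (Suc i)) - g (p i))" by (rule sum_lessThan_telescope[of "\<lambda>i. g (p i)" n, symmetric])
    finally have "\<bar>g (\<gamma> 1) - g (\<gamma> 0)\<bar> \<le> (\<Sum>i<n. \<bar>g (p (Suc i)) - g (p i)\<bar>)" by simp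
    also have "\<dots> \<le> (\<Sum>i<n. (M + \<epsilon>) * dist (p i) (p (Suc i)))" using step by (intro sum_mono) auto
    also have "\<dots> = (M + \<epsilon>) * (\<Sum>i<n. dist (p i) (p (Suc i)))" by (simp add: sum_distrib_left)
    also have "\<dots> \<le> (M + \<epsilon>) * L"
      unfolding p_def using M e by (intro mult_left_mono len uniform_partition[OF n(1)]) auto
    finally show ?thesis .
  qed
  have L: "0 \<le> L" using quasiconvex_curve_stays_close[where \<gamma> = \<gamma> and s = 0, OF len] by simp
  show ?thesis
  proof (rule field_le_epsilon)
    fix e :: real assume e: "0 < e"
    have "\<bar>g (\<gamma> 1) - g (\<gamma> 0)\<bar> \<le> (M + e / (L + 1)) * L" using e L by (intro approx) auto
    also have "\<dots> = M * L + e * (L / (L + 1))" by (simp add: algebra_simps)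
    also have "e * (L / (L + 1)) \<le> e * 1" using e L by (intro mult_left_mono) auto
    finally show "\<bar>g (\<gamma> 1) - g (\<gamma> 0)\<bar> \<le> M * L + e" by simp
  qed
qed

text \<open>
  The points of a connecting curve have distance at most its length from \<open>x\<close>, so the hypothesis on
  \<open>Df\<close> holds all along the curve, and the mean value inequality applies to \<open>f\<close> minus its linear
  part at \<open>x\<close>.
\<close>

lemma taylor_bound_quasiconvex:
  fixes f :: "'a::real_normed_vector \<Rightarrow> real" and Df :: "'a \<Rightarrow> 'a \<Rightarrow>\<^sub>L real"
  assumes U: "open U" and qc: "quasiconvex_with c U" and c: "0 \<le> c"
    and der: "\<And>u. u \<in> U \<Longrightarrow> (f has_derivative blinfun_apply (Df u)) (at u)"
    and uc: "uniformly_continuous_on U Df" and xy: "x \<in> U" "y \<in> U" and w: "0 \<le> w"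
    and bd: "\<And>u. u \<in> U \<Longrightarrow> norm (u - x) \<le> c * norm (x - y) \<Longrightarrow> norm (Df u - Df x) \<le> w"
  shows "\<bar>f y - f x - Df x (y - x)\<bar> \<le> w * (c * norm (x - y))"
proof -
  obtain \<gamma> where \<gamma>: "path \<gamma>" "path_image \<gamma> \<subseteq> U" "\<gamma> 0 = x" "\<gamma> 1 = y"
    and len: "\<And>n t. mono_on {..n} t \<Longrightarrow> t ` {..n} \<subseteq> {0..1} \<Longrightarrow>
       (\<Sum>i<n. dist (\<gamma> (t i)) (\<gamma> (t (Suc i)))) \<le> c * dist x y"
    using quasiconvex_with_curve[OF qc c xy] by blast
  define g where "g u = f u - Df x (u - x)" for u
  have "\<bar>g (\<gamma> 1) - g (\<gamma> 0)\<bar> \<le> w * (c * dist x y)"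
  proof (rule increment_bound_along_curve[OF U _ _ w \<gamma>(1,2) _ len, where g' = "\<lambda>u. Df u - Df x"])
    show "(g has_derivative blinfun_apply (Df u - Df x)) (at u)" if "u \<in> U" for u
      unfolding g_def[abs_def] blinfun.diff_left
      by (auto intro!: derivative_eq_intros der[OF that] simp: blinfun.diff_right)
    show "uniformly_continuous_on U (\<lambda>u. Df u - Df x)"
      by (intro uniformly_continuous_on_diff uc uniformly_continuous_on_const)
    show "norm (Df (\<gamma> s) - Df x) \<le> w" if "s \<in> {0..1}" for s
    proof (rule bd)
      show "\<gamma> s \<in> U" using \<gamma>(2) that by (auto simp: path_image_def)
      show "norm (\<gamma> s - x) \<le> c * norm (x - y)"
        using quasiconvex_curve_stays_close[where \<gamma> = \<gamma>, OF len that] \<gamma>(3)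
        by (simp add: dist_norm norm_minus_commute)
    qed
  qed
  then show ?thesis unfolding \<gamma>(3,4) g_def by (simp add: blinfun.zero_right dist_norm)
qed

text \<open>
  Walk along a short curve from \<open>x\<close> to \<open>y\<close> in small steps and change the current anchor only when
  its distance to the current point exceeds \<open>r\<close>. Each change costs at most 1 in the value of \<open>D\<close> but
  uses up at least \<open>r\<close> of the length, so there are at most \<open>c \<parallel>x - y\<parallel> / r\<close> changes. The summand 1
  is the step from the last anchor to \<open>y\<close>.
\<close>

lemma quasiconvex_uniformly_continuous_growth:
  fixes D :: "'a::real_normed_vector \<Rightarrow> 'b::real_normed_vector"
  assumes qc: "quasiconvex_with c U" and c: "0 \<le> c" and uc: "uniformly_continuous_on U D"
  obtains B where "0 \<le> B" "\<And>x y. x \<in> U \<Longrightarrow> y \<in> U \<Longrightarrow> norm (D x - D y) \<le> 1 + B * norm (x - y)"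
proof -
  obtain d where d: "0 < d" "\<And>u v. u \<in> U \<Longrightarrow> v \<in> U \<Longrightarrow> dist u v < d \<Longrightarrow> dist (D u) (D v) < 1"
    using uc unfolding uniformly_continuous_on_def by (meson zero_less_one)
  define r where "r = d / 2"
  have r: "0 < r" using d by (simp add: r_def)
  have "norm (D x - D y) \<le> 1 + (c / r) * norm (x - y)" if xy: "x \<in> U" "y \<in> U" for x y
  proof -
    obtain \<gamma> where \<gamma>: "path \<gamma>" "path_image \<gamma> \<subseteq> U" "\<gamma> 0 = x" "\<gamma> 1 = y"
      and len: "\<And>n t. mono_on {..n} t \<Longrightarrow> t ` {..n} \<subseteq> {0..1} \<Longrightarrow>
         (\<Sum>i<n. dist (\<gamma> (t i)) (\<gamma> (t (Suc i)))) \<le> c * dist x y"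
      using quasiconvex_with_curve[OF qc c xy] by blast
    obtain n where n: "0 < n"
      "\<And>i. i < n \<Longrightarrow> dist (\<gamma> (real i / real n)) (\<gamma> (real (Suc i) / real n)) < r"
      using path_fine_partition[OF \<gamma>(1) r] by blast
    define p where "p i = \<gamma> (real i / real n)" for i
    define S where "S m = (\<Sum>i<m. dist (p i) (p (Suc i)))" for m
    have pU: "p i \<in> U" if "i \<le> n" for i
    proof -
      have "real i / real n \<in> {0..1}" using that by (auto simp: divide_le_eq)
      then show ?thesis using \<gamma>(2) unfolding p_def path_image_def by blast
    qed
    have S_dist: "dist (p j) (p m) \<le> S m - S j" if "j \<le> m" for j m
      using that
    proof (induction rule: dec_induct)
      case base then show ?case by simp
    next
      case (step m)
      then show ?case using dist_triangle[of "p j" "p (Suc m)" "p m"] by (simp add: S_def)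
    qed
    \<comment> \<open>\<open>p j\<close> is the anchor after \<open>m\<close> steps; \<open>S j\<close> is the length spent until it was chosen\<close>
    have anchor: "\<exists>j\<le>m. dist (p m) (p j) \<le> r \<and> r * norm (D (p j) - D (p 0)) \<le> S j" if "m \<le> n" for m
      using that
    proof (induction m)
      case 0
      show ?case using r by (auto simp: S_def)
    next
      case (Suc m)
      then obtain j where j: "j \<le> m" "dist (p m) (p j) \<le> r" "r * norm (D (p j) - D (p 0)) \<le> S j" by auto
      show ?case
      proof (cases "dist (p (Suc m)) (p j) \<le> r")
        case True
        then show ?thesis using j le_SucI by blast
      next
        case False
        have "dist (p m) (p (Suc m)) < r" using n(2)[of m] Suc.prems by (simp add: p_def)
        then have "dist (p (Suc m)) (p j) < d"
          using j(2) dist_triangle[of "p (Suc m)" "p j" "p m"] by (simp add: r_def dist_commute)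
        then have "dist (D (p (Suc m))) (D (p j)) < 1"
          using j(1) Suc.prems by (intro d(2) pU) auto
        then have "norm (D (p (Suc m)) - D (p 0)) \<le> 1 + norm (D (p j) - D (p 0))"
          using norm_triangle_ineq[of "D (p (Suc m)) - D (p j)" "D (p j) - D (p 0)"] by (simp add: dist_norm)
        then have "r * norm (D (p (Suc m)) - D (p 0)) \<le> r * (1 + norm (D (p j) - D (p 0)))"
          using r by (intro mult_left_mono) auto
        also have "\<dots> \<le> r + S j" using j(3) by (simp add: algebra_simps)
        also have "\<dots> \<le> S (Suc m)" using False S_dist[of j "Suc m"] j(1) by (simp add: dist_commute)
        finally show ?thesis using r by (intro exI[of _ "Suc m"]) auto
      qed
    qed
    obtain j where j: "j \<le> n" "dist (p n) (p j) \<le> r" "r * norm (D (p j) - D (p 0)) \<le> S j"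
      using anchor[of n] by auto
    have ends: "p 0 = x" "p n = y" using \<gamma>(3,4) n(1) by (auto simp: p_def)
    have "S j \<le> S n" using S_dist[OF j(1)] zero_le_dist[of "p j" "p n"] by linarith
    also have "S n \<le> c * dist x y" unfolding S_def p_def by (rule len[OF uniform_partition[OF n(1)]])
    finally have "r * norm (D (p j) - D x) \<le> c * norm (x - y)" using j(3) by (simp add: ends dist_norm)
    then have "norm (D (p j) - D x) \<le> (c / r) * norm (x - y)" using r by (simp add: field_simps)
    moreover have "dist (D y) (D (p j)) < 1"
      using j r pU[OF j(1)] xy by (intro d(2)) (auto simp: ends r_def)
    ultimately show ?thesis
      using norm_triangle_ineq[of "D (p j) - D x" "D y - D (p j)"] by (simp add: dist_norm norm_minus_commute)
  qed
  then show thesis using that[of "c / r"] c r by simp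
qed

section \<open>Extension of Whitney jets\<close>

text \<open>
  The compatibility condition says \<open>lo \<le> up\<close> for the two envelopes; taking \<open>y = x\<close> shows that each
  of them is pinched to \<open>f\<close> on \<open>U\<close>. The inserted function is bounded on balls because it lies
  between one summand of \<open>lo\<close> and one summand of \<open>up\<close>.
\<close>

lemma whitney_jet_extension:
  fixes f :: "'a::real_normed_vector \<Rightarrow> real" and D :: "'a \<Rightarrow> 'a \<Rightarrow>\<^sub>L real"
  assumes \<phi>: "uniformly_smooth_convex \<phi>"
    and compat: "\<And>x y z. y \<in> U \<Longrightarrow> z \<in> U \<Longrightarrow>
      f y + D y (x - y) - \<phi> (x - y) \<le> f z + D z (x - z) + \<phi> (x - z)"
  obtains F where "F C1_plus_on UNIV" "\<And>x. x \<in> U \<Longrightarrow> F x = f x"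
proof (cases "U = {}")
  case True
  have "(\<lambda>_. 0) C1_plus_on (UNIV :: 'a set)"
    unfolding C1_plus_on_def
    by (intro exI[of _ "\<lambda>_. 0"]) (auto intro!: derivative_eq_intros uniformly_continuous_on_const)
  then show thesis using that True by blast
next
  case False
  have \<phi>0: "\<phi> 0 = 0" using \<phi> by (simp add: uniformly_smooth_convex_def)
  obtain \<delta> where \<delta>: "\<And>\<epsilon>. 0 < \<epsilon> \<Longrightarrow> 0 < \<delta> \<epsilon>" and sc: "semiconvex_gauge \<delta> (\<lambda>x. - \<phi> x)"
    using uniformly_smooth_convex_imp_semiconcave[OF \<phi>] by blast
  have piece: "semiconvex_gauge \<delta> (\<lambda>x. s * f y + s * D y (x - y) - \<phi> (x - y))" for s y
  proof -
    have "linear (\<lambda>x. s * D y x)"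
      by (rule linearI) (simp_all add: blinfun.add_right blinfun.scaleR_right algebra_simps)
    then have "semiconvex_gauge \<delta> (\<lambda>x. (s * f y - s * D y y) + s * D y x + - \<phi> (x + - y))"
      by (intro semiconvex_gauge_add_affine semiconvex_gauge_translate sc)
    then show ?thesis by (simp add: blinfun.diff_right algebra_simps)
  qed
  define lo where "lo x = (SUP y\<in>U. f y + D y (x - y) - \<phi> (x - y))" for x
  define up where "up x = - (SUP y\<in>U. - f y - D y (x - y) - \<phi> (x - y))" for x
  have bdd: "bdd_above ((\<lambda>y. f y + D y (x - y) - \<phi> (x - y)) ` U)"
    "bdd_above ((\<lambda>y. - f y - D y (x - y) - \<phi> (x - y)) ` U)" for x
  proof -
    obtain z where z: "z \<in> U" using False by blast
    show "bdd_above ((\<lambda>y. f y + D y (x - y) - \<phi> (x - y)) ` U)"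
      by (rule bdd_aboveI[of _ "f z + D z (x - z) + \<phi> (x - z)"]) (use compat[OF _ z] in auto)
    show "bdd_above ((\<lambda>y. - f y - D y (x - y) - \<phi> (x - y)) ` U)"
    proof (rule bdd_aboveI[of _ "- (f z + D z (x - z) - \<phi> (x - z))"])
      fix s assume "s \<in> (\<lambda>y. - f y - D y (x - y) - \<phi> (x - y)) ` U"
      then obtain y where "y \<in> U" "s = - f y - D y (x - y) - \<phi> (x - y)" by blast
      then show "s \<le> - (f z + D z (x - z) - \<phi> (x - z))" using compat[OF z, of y x] by linarith
    qed
  qed
  have lo_ge: "f y + D y (x - y) - \<phi> (x - y) \<le> lo x" if "y \<in> U" for x y
    unfolding lo_def by (rule cSUP_upper[OF that bdd(1)])
  have up_le: "up x \<le> f y + D y (x - y) + \<phi> (x - y)" if "y \<in> U" for x y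
    unfolding up_def using cSUP_upper[OF that bdd(2), of x] by linarith
  have lo_up: "lo x \<le> up x" for x
    unfolding lo_def
  proof (rule cSUP_least[OF False])
    fix y assume y: "y \<in> U"
    have "(SUP z\<in>U. - f z - D z (x - z) - \<phi> (x - z)) \<le> - (f y + D y (x - y) - \<phi> (x - y))"
    proof (rule cSUP_least[OF False])
      fix z assume "z \<in> U"
      then show "- f z - D z (x - z) - \<phi> (x - z) \<le> - (f y + D y (x - y) - \<phi> (x - y))"
        using compat[OF y, of z x] by linarith
    qed
    then show "f y + D y (x - y) - \<phi> (x - y) \<le> up x" unfolding up_def by linarith
  qed
  have sc_lo: "semiconvex_gauge \<delta> lo"
    unfolding lo_def[abs_def] using piece[of 1] by (intro semiconvex_gauge_SUP False bdd) simp
  have sc_up: "semiconvex_gauge \<delta> (\<lambda>x. - up x)"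
    unfolding up_def minus_minus using piece[of "- 1"] by (intro semiconvex_gauge_SUP False bdd) simp
  obtain F where F: "semiconvex_gauge \<delta> F" "semiconvex_gauge \<delta> (\<lambda>x. - F x)"
    and sandwich: "\<And>x. lo x \<le> F x" "\<And>x. F x \<le> up x"
    by (rule semiconvex_semiconcave_insertion[where lo = lo and up = up, OF sc_lo sc_up lo_up]) (rule that)
  obtain z where z: "z \<in> U" using False by blast
  have "bounded (F ` cball x r)" for x r
  proof -
    have "bounded (\<phi> ` cball (x - z) r)" using \<phi> by (simp add: uniformly_smooth_convex_def)
    then obtain B where B: "\<And>v. v \<in> cball (x - z) r \<Longrightarrow> \<bar>\<phi> v\<bar> \<le> B"
      unfolding bounded_iff real_norm_def by blast
    show ?thesis
      unfolding bounded_iff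
    proof (intro exI ballI)
      fix s assume "s \<in> F ` cball x r"
      then obtain v where v: "s = F v" "dist x v \<le> r" by auto
      have "v - z \<in> cball (x - z) r" using v(2) by (simp add: dist_norm)
      then have "\<bar>\<phi> (v - z)\<bar> \<le> B" by (rule B)
      moreover have "\<bar>F v\<bar> \<le> \<bar>f z\<bar> + \<bar>D z (v - z)\<bar> + \<bar>\<phi> (v - z)\<bar>"
        using lo_ge[OF z, of v] up_le[OF z, of v] sandwich[of v] by linarith
      moreover have "\<bar>D z (v - z)\<bar> \<le> norm (D z) * (r + norm (x - z))"
      proof -
        have "norm (v - z) \<le> norm (v - x) + norm (x - z)"
          using norm_triangle_ineq[of "v - x" "x - z"] by simp
        then have "norm (v - z) \<le> r + norm (x - z)" using v(2) by (simp add: dist_norm norm_minus_commute)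
        then have "norm (D z) * norm (v - z) \<le> norm (D z) * (r + norm (x - z))"
          by (rule mult_left_mono) simp
        then show ?thesis using norm_blinfun[of "D z" "v - z"] by simp
      qed
      ultimately show "norm s \<le> \<bar>f z\<bar> + norm (D z) * (r + norm (x - z)) + B" using v(1) by simp
    qed
  qed
  then have "F C1_plus_on UNIV" by (intro semiconvex_semiconcave_C1_plus[OF F] \<delta>)
  moreover have "F x = f x" if "x \<in> U" for x
    using lo_ge[OF that, of x] up_le[OF that, of x] sandwich[of x] \<phi>0 by (simp add: blinfun.zero_right)
  ultimately show thesis using that by blast
qed

text \<open>
  If \<open>w\<close> were the modulus of continuity \<open>\<omega>\<close> of \<open>D\<close> at \<open>r \<parallel>x\<parallel>\<close>, the last inequality would read
  \<open>a \<parallel>x\<parallel> \<omega> (r \<parallel>x\<parallel>) \<le> \<phi> x\<close>; an upper bound \<open>w\<close> serves equally well. Below the scale \<open>d 0\<close> the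
  bounds \<open>w\<close> are powers of \<open>1/2\<close>, matched by the superposition; above it the affine growth bound is
  used, whose linear part calls for the quadratic function.
\<close>

lemma smooth_majorant_of_modulus:
  fixes D :: "'a::real_normed_vector \<Rightarrow> 'b::real_normed_vector"
  assumes N: "equivalent_norm (N :: 'a \<Rightarrow> real)" "uniformly_smooth N"
    and uc: "uniformly_continuous_on U D"
    and growth: "\<And>u v. u \<in> U \<Longrightarrow> v \<in> U \<Longrightarrow> norm (D u - D v) \<le> A + B * norm (u - v)" "0 \<le> A" "0 \<le> B"
    and B: "B = 0 \<or> (\<exists>N :: 'a \<Rightarrow> real. equivalent_norm N \<and> smoothness_power_type N 2)"
    and a: "0 \<le> a" and r: "0 < r"
  obtains \<phi> :: "'a \<Rightarrow> real" where "uniformly_smooth_convex \<phi>"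
    "\<And>x. \<exists>w\<ge>0. (\<forall>u\<in>U. \<forall>v\<in>U. norm (u - v) \<le> r * norm x \<longrightarrow> norm (D u - D v) \<le> w) \<and> a * norm x * w \<le> \<phi> x"
proof -
  have "\<forall>k::nat. \<exists>e>0. \<forall>v\<in>U. \<forall>u\<in>U. dist u v < e \<longrightarrow> dist (D u) (D v) < (1/2) ^ k"
    using uc unfolding uniformly_continuous_on_def by simp
  then obtain e :: "nat \<Rightarrow> real" where e: "\<And>k. 0 < e k"
    "\<And>k u v. u \<in> U \<Longrightarrow> v \<in> U \<Longrightarrow> dist u v < e k \<Longrightarrow> dist (D u) (D v) < (1/2) ^ k"
    by metis
  define d where "d k = min (e k) ((1/2) ^ k) / r" for k
  have d: "0 < d k" "r * d k \<le> e k" "r * d k \<le> (1/2) ^ k" for k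
    using e(1)[of k] r by (simp_all add: d_def)
  obtain \<theta> :: "'a \<Rightarrow> real" and M where \<theta>: "0 < M" "uniformly_smooth_convex \<theta>"
    "\<And>v. \<theta> v \<le> M * norm v" "\<And>v. 1 \<le> norm v \<Longrightarrow> norm v \<le> \<theta> v"
    "\<And>x h. \<theta> (x + h) + \<theta> (x - h) - 2 * \<theta> x \<le> M * norm h"
    by (rule smooth_convex_of_linear_growth[OF N]) (rule that)
  obtain \<psi> :: "'a \<Rightarrow> real" where \<psi>: "uniformly_smooth_convex \<psi>"
    "\<And>k v. d k \<le> norm v \<Longrightarrow> (1/2) ^ k * norm v \<le> \<psi> v"
    by (rule superposition_of_scales[OF \<theta>, of d]) (assumption | rule d(1) | rule that)+
  obtain q :: "'a \<Rightarrow> real" where q: "uniformly_smooth_convex q" "\<And>v. B * norm v ^ 2 \<le> B * q v"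
  proof (cases "B = 0")
    case True
    \<comment> \<open>the coefficient vanishes, so any uniformly smooth convex function may be used\<close>
    then show thesis using that[OF \<psi>(1)] by simp
  next
    case False
    then obtain N2 :: "'a \<Rightarrow> real" where "equivalent_norm N2" "smoothness_power_type N2 2" using B by blast
    then obtain q :: "'a \<Rightarrow> real" where "uniformly_smooth_convex q" "\<And>v. norm v ^ 2 \<le> q v"
      by (rule smooth_convex_of_quadratic_growth) (rule that)
    then show thesis using that[of q] growth(3) by (simp add: mult_left_mono)
  qed
  have \<psi>0: "0 \<le> \<psi> x" and q0: "0 \<le> q x" for x
    using \<psi>(1) q(1) by (simp_all add: uniformly_smooth_convex_def)
  define \<phi> where "\<phi> x = (a * (2 + A)) * \<psi> x + (a * r) * (B * q x)" for x
  have "uniformly_smooth_convex (\<lambda>x. (a * (2 + A)) * \<psi> x + (a * r * B) * q x)"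
    using a r growth by (intro uniformly_smooth_convex_combination \<psi> q) auto
  then have "uniformly_smooth_convex \<phi>" by (simp add: \<phi>_def[abs_def] mult.assoc)
  moreover have "\<exists>w\<ge>0. (\<forall>u\<in>U. \<forall>v\<in>U. norm (u - v) \<le> r * norm x \<longrightarrow> norm (D u - D v) \<le> w)
      \<and> a * norm x * w \<le> \<phi> x" for x
  proof (cases "x = 0")
    case True
    then show ?thesis using a r growth(2,3) \<psi>0[of x] q0[of x] by (intro exI[of _ 0]) (simp add: \<phi>_def)
  next
    case x: False
    have "\<exists>k. d k \<le> norm x"
    proof -
      obtain k where "(1/2::real) ^ k < r * norm x" using real_arch_pow_inv[of "r * norm x" "1/2"] x r by auto
      then have "r * d k \<le> r * norm x" using d(3)[of k] by linarith
      then show ?thesis using r by auto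
    qed
    then obtain j where j: "d j \<le> norm x" "\<And>i. i < j \<Longrightarrow> norm x < d i"
      using exists_least_iff[of "\<lambda>k. d k \<le> norm x"] by (auto simp: not_le)
    have aq: "0 \<le> (a * r) * (B * q x)" using a r growth(3) q0 by simp
    show ?thesis
    proof (cases j)
      case 0
      have "norm x \<le> \<psi> x" using \<psi>(2)[OF j(1)] 0 by simp
      then have "a * (2 + A) * norm x \<le> a * (2 + A) * \<psi> x" using a growth(2) by (intro mult_left_mono) auto
      moreover have "(a * r) * (B * norm x ^ 2) \<le> (a * r) * (B * q x)"
        using a r by (intro mult_left_mono q(2)) auto
      moreover have "a * norm x * (A + B * (r * norm x)) \<le> a * (2 + A) * norm x + (a * r) * (B * norm x ^ 2)"
        using a by (simp add: algebra_simps power2_eq_square)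
      ultimately have "a * norm x * (A + B * (r * norm x)) \<le> \<phi> x" unfolding \<phi>_def by linarith
      moreover have "norm (D u - D v) \<le> A + B * (r * norm x)"
        if "u \<in> U" "v \<in> U" "norm (u - v) \<le> r * norm x" for u v
        using growth(1)[OF that(1,2)] mult_left_mono[OF that(3) growth(3)] by linarith
      ultimately show ?thesis
        using growth(2,3) r by (intro exI[of _ "A + B * (r * norm x)"]) auto
    next
      case (Suc i)
      \<comment> \<open>the scale is below \<open>d i\<close> but not below \<open>d j\<close>: the bound \<open>1/2 ^ i\<close> loses only a factor 2
        against the weight \<open>1/2 ^ j\<close> of the superposition, whence the 2 in \<open>2 + A\<close>\<close>
      have "norm x < d i" using j(2) Suc by simp
      then have small: "r * norm x < e i" using d(2)[of i] r mult_strict_left_mono[of "norm x" "d i" r] by linarith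
      have "(1/2) ^ i * norm x = 2 * ((1/2) ^ j * norm x)" using Suc by simp
      also have "\<dots> \<le> 2 * \<psi> x" using \<psi>(2)[OF j(1)] by simp
      also have "\<dots> \<le> (2 + A) * \<psi> x" using growth(2) \<psi>0 by (intro mult_right_mono) auto
      finally have "a * ((1/2) ^ i * norm x) \<le> a * ((2 + A) * \<psi> x)" using a by (rule mult_left_mono)
      then have "a * norm x * (1/2) ^ i \<le> \<phi> x" unfolding \<phi>_def using aq by (simp add: mult_ac)
      moreover have "norm (D u - D v) \<le> (1/2) ^ i"
        if "u \<in> U" "v \<in> U" "norm (u - v) \<le> r * norm x" for u v
        using e(2)[OF that(1,2), of i] that(3) small by (simp add: dist_norm)
      ultimately show ?thesis by (intro exI[of _ "(1/2) ^ i"]) auto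
    qed
  qed
  ultimately show thesis using that by blast
qed

theorem corollary57:
  fixes U :: "'a::banach set" and f :: "'a \<Rightarrow> real"
  assumes "super_reflexive TYPE('a)"
    and "open U" and "quasiconvex U"
    and "f C1_plus_on U"
    and "(\<exists>N :: 'a \<Rightarrow> real. equivalent_norm N \<and> smoothness_power_type N 2) \<or> bounded U"
  shows "\<exists>F :: 'a \<Rightarrow> real. F C1_plus_on UNIV \<and> (\<forall>x\<in>U. F x = f x)"
proof -
  obtain N :: "'a \<Rightarrow> real" where N: "equivalent_norm N" "uniformly_smooth N"
    using assms(1) unfolding super_reflexive_def by blast
  obtain c where c: "1 \<le> c" and qc: "quasiconvex_with c U"
    using assms(3) unfolding quasiconvex_def by blast
  have c0: "0 \<le> c" using c by simp
  obtain Df :: "'a \<Rightarrow> 'a \<Rightarrow>\<^sub>L real" where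
    der: "\<And>x. x \<in> U \<Longrightarrow> (f has_derivative blinfun_apply (Df x)) (at x)" and uc: "uniformly_continuous_on U Df"
    using assms(4) unfolding C1_plus_on_def by blast
  obtain B0 where B0: "0 \<le> B0" "\<And>u v. u \<in> U \<Longrightarrow> v \<in> U \<Longrightarrow> norm (Df u - Df v) \<le> 1 + B0 * norm (u - v)"
    using quasiconvex_uniformly_continuous_growth[OF qc c0 uc] by blast
  obtain A B where AB: "0 \<le> A" "0 \<le> B"
    "\<And>u v. u \<in> U \<Longrightarrow> v \<in> U \<Longrightarrow> norm (Df u - Df v) \<le> A + B * norm (u - v)"
    "B = 0 \<or> (\<exists>N :: 'a \<Rightarrow> real. equivalent_norm N \<and> smoothness_power_type N 2)"
  proof (cases "bounded U")
    case True
    then obtain R where R: "\<And>u v. u \<in> U \<Longrightarrow> v \<in> U \<Longrightarrow> dist u v \<le> R"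
      unfolding bounded_two_points by blast
    have "norm (Df u - Df v) \<le> (1 + B0 * \<bar>R\<bar>) + 0 * norm (u - v)" if "u \<in> U" "v \<in> U" for u v
    proof -
      have "B0 * norm (u - v) \<le> B0 * \<bar>R\<bar>" using R[OF that] B0(1) by (intro mult_left_mono) (auto simp: dist_norm)
      then show ?thesis using B0(2)[OF that] by simp
    qed
    then show thesis using that[of "1 + B0 * \<bar>R\<bar>" 0] B0(1) by simp
  next
    case False
    then show thesis using that[of 1 B0] B0 assms(5) by simp
  qed
  obtain \<phi> :: "'a \<Rightarrow> real" where \<phi>: "uniformly_smooth_convex \<phi>" and maj:
    "\<And>x. \<exists>w\<ge>0. (\<forall>u\<in>U. \<forall>v\<in>U. norm (u - v) \<le> (2 * c) * norm x \<longrightarrow> norm (Df u - Df v) \<le> w)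
      \<and> (3 * c) * norm x * w \<le> \<phi> x"
  proof (rule smooth_majorant_of_modulus[OF N uc AB(3,1,2,4), of "3 * c" "2 * c"])
    show "0 \<le> 3 * c" "0 < 2 * c" using c by simp_all
  qed (assumption | rule that)+
  have \<phi>0: "0 \<le> \<phi> x" for x using \<phi> by (simp add: uniformly_smooth_convex_def)
  have compat: "f y + Df y (x - y) - \<phi> (x - y) \<le> f z + Df z (x - z) + \<phi> (x - z)"
    if yz: "y \<in> U" "z \<in> U" for x y z
  proof -
    \<comment> \<open>measure everything at the larger of the two distances; \<open>\<phi>\<close> at the other one is nonnegative\<close>
    define v where "v = (if norm (x - z) \<le> norm (x - y) then x - y else x - z)"
    have v: "norm (x - y) \<le> norm v" "norm (x - z) \<le> norm v" "\<phi> v \<le> \<phi> (x - y) + \<phi> (x - z)"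
      using \<phi>0 by (auto simp: v_def)
    obtain w where w: "0 \<le> w" "(3 * c) * norm v * w \<le> \<phi> v"
      "\<And>u u'. u \<in> U \<Longrightarrow> u' \<in> U \<Longrightarrow> norm (u - u') \<le> (2 * c) * norm v \<Longrightarrow> norm (Df u - Df u') \<le> w"
      using maj[of v] by blast
    have yz2: "norm (z - y) \<le> 2 * norm v"
      using norm_triangle_ineq4[of "x - y" "x - z"] v by simp
    have czy: "c * norm (z - y) \<le> (2 * c) * norm v" using mult_left_mono[OF yz2 c0] by simp
    have "\<bar>f y - f z - Df z (y - z)\<bar> \<le> w * (c * norm (z - y))"
    proof (rule taylor_bound_quasiconvex[OF assms(2) qc c0 der uc yz(2,1) w(1)])
      show "norm (Df u - Df z) \<le> w" if "u \<in> U" "norm (u - z) \<le> c * norm (z - y)" for u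
        using that czy by (intro w(3) yz) auto
    qed
    also have "\<dots> \<le> w * ((2 * c) * norm v)" using czy w(1) by (rule mult_left_mono)
    finally have 1: "\<bar>f y - f z - Df z (y - z)\<bar> \<le> w * ((2 * c) * norm v)" .
    have "norm (Df y - Df z) \<le> w"
    proof (rule w(3)[OF yz])
      have "norm (z - y) \<le> c * norm (z - y)" using c mult_right_mono[of 1 c "norm (z - y)"] by simp
      then show "norm (y - z) \<le> (2 * c) * norm v" using czy by (simp add: norm_minus_commute)
    qed
    then have "norm (Df y - Df z) * norm (x - y) \<le> w * norm v" using v(1) w(1) by (intro mult_mono) auto
    also have "\<dots> \<le> w * (c * norm v)"
      using c w(1) mult_right_mono[of 1 c "norm v"] by (intro mult_left_mono) auto
    finally have 2: "\<bar>(Df y - Df z) (x - y)\<bar> \<le> w * (c * norm v)"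
      using norm_blinfun[of "Df y - Df z" "x - y"] by simp
    have "f y + Df y (x - y) - (f z + Df z (x - z)) = (f y - f z - Df z (y - z)) + (Df y - Df z) (x - y)"
      by (simp add: blinfun.diff_left blinfun.diff_right)
    also have "\<dots> \<le> w * ((2 * c) * norm v) + w * (c * norm v)" using 1 2 by linarith
    also have "\<dots> = (3 * c) * norm v * w" by (simp add: algebra_simps)
    finally show ?thesis using w(2) v(3) by linarith
  qed
  show ?thesis
  proof (rule whitney_jet_extension[OF \<phi>, where f = f and D = Df and U = U])
    show "f y + Df y (x - y) - \<phi> (x - y) \<le> f z + Df z (x - z) + \<phi> (x - z)"
      if "y \<in> U" "z \<in> U" for x y z
      by (rule compat[OF that])
  qed blast
qed

end
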